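(* Let $\kappa$ be a regular uncountable cardinal and suppose $\mathrm{P}_{14}(\kappa,\sqsubseteq,1,\{\kappa\})$ holds. Then there exists a downward-closed subtree $T\subseteq{}^{<\kappa}\kappa$ which, ordered by proper inclusion, is a prolific slim $\kappa$-Souslin tree admitting an injective $\mathcal F^{\mathrm{fin}}_{\aleph_0}$-ascent path.
   Context: For a downward-closed $T\subseteq{}^{<\kappa}\kappa$ ordered by $\subsetneq$, the height of $t$ is $\mathrm{dom}(t)$ and $T_\alpha=T\cap{}^\alpha\kappa$. $T$ is prolific if for every $\alpha<\kappa$ and $x\in T_\alpha$, $x^\frown\langle i\rangle\in T$ for all $i<\max\{\omega,\alpha\}$; slim if $|T_\alpha|\le\max\{|\alpha|,\aleph_0\}$ for all $\alpha$; $\kappa$-Souslin if it has height $\kappa$, levels of size $<\kappa$, no cofinal branch and no antichain of size $\kappa$. $\mathcal F^{\mathrm{fin}}_{\aleph_0}=\{Z\subseteq\omega\mid\omega\setminus Z$ finite$\}$. An $\mathcal F^{\mathrm{fin}}_{\aleph_0}$-ascent path is $\langle f_\alpha\mid\alpha<\kappa\rangle$ with $f_\alpha:\omega\to T_\alpha$ and $\{n\mid f_\alpha(n)\subsetneq f_\beta(n)\}\in\mathcal F^{\mathrm{fin}}_{\aleph_0}$ for $\alpha<\beta<\kappa$; it is injective if some $f_\alpha\restriction I$ is injective with $I\in\mathcal F^{\mathrm{fin}}_{\aleph_0}$. Proxy principle: $\mathrm{acc}(D)=\{\alpha\in D\mid\sup(D\cap\alpha)=\alpha>0\}$, $\mathrm{succ}_\omega(D)=\{\delta\in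 D\mid0<\mathrm{otp}(D\cap\delta)<\omega\}$; $D\sqsubseteq C$ iff $D=C\cap\beta$ for some $\beta$. $\mathrm{P}^-_{14}(\kappa,\mathcal R,\mu,\mathcal S)$ (for a binary relation $\mathcal R$, cardinal $1\le\mu\le\kappa$, nonempty family $\mathcal S$ of stationary subsets of $\kappa$) asserts the existence of $\langle C_\alpha\mid\alpha<\kappa\rangle$ with: $C_\alpha$ club in $\alpha$ for limit $\alpha$; $C_{\bar\alpha}\mathrel{\mathcal R}C_\alpha$ whenever $\bar\alpha\in\mathrm{acc}(C_\alpha)$; for every sequence $\langle A_i\mid i<\mu\rangle$ of cofinal subsets of $\kappa$ and $S\in\mathcal S$, stationarily many $\alpha\in S$ satisfy $\sup\{\beta\in C_\alpha\mid\mathrm{succ}_\omega(C_\alpha\setminus\beta)\subseteq A_i\}=\alpha$ for all $i<\min\{\alpha,\mu\}$. $\mathrm{P}_{14}(\kappa,\mathcal R,\mu,\mathcal S)$ means $\mathrm{P}^-_{14}(\kappa,\mathcal R,\mu,\mathcal S)$ together with $\diamondsuit(\kappa)$. *)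

theory Defs
  imports Main "HOL-Library.Equipollence" "HOL-Library.Countable_Set"
begin

text \<open>The cardinal kappa is represented by a well-ordered type 'k: the ordinals
  below kappa are the elements of 'k, and the ordinal alpha (as a set) is {..<alpha}.\<close>

definition reg_uncountable_cardinal :: "'k::wellorder itself \<Rightarrow> bool" where
  "reg_uncountable_cardinal _ \<longleftrightarrow>
     (\<forall>\<alpha>::'k. {..<\<alpha>} \<prec> (UNIV::'k set))
   \<and> \<not> countable (UNIV::'k set)
   \<and> (\<forall>A::'k set. A \<prec> (UNIV::'k set) \<longrightarrow> (\<exists>\<alpha>. A \<subseteq> {..<\<alpha>}))"

text \<open>sup X = alpha (least upper bound in the ordinals; sup of the empty set is 0)\<close>
definition sup_is :: "'k::wellorder set \<Rightarrow> 'k \<Rightarrow> bool" where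
  "sup_is X \<alpha> \<longleftrightarrow> (\<forall>x\<in>X. x \<le> \<alpha>) \<and> (\<forall>\<delta><\<alpha>. \<exists>x\<in>X. \<delta> < x)"

definition is_limit :: "'k::wellorder \<Rightarrow> bool" where
  "is_limit \<alpha> \<longleftrightarrow> (\<exists>\<beta>. \<beta> < \<alpha>) \<and> (\<forall>\<beta><\<alpha>. \<exists>\<gamma>. \<beta> < \<gamma> \<and> \<gamma> < \<alpha>)"

definition acc :: "'k::wellorder set \<Rightarrow> 'k set" where
  "acc D = {\<alpha>\<in>D. sup_is (D \<inter> {..<\<alpha>}) \<alpha> \<and> (\<exists>\<beta>. \<beta> < \<alpha>)}"

definition succ_omega :: "'k::wellorder set \<Rightarrow> 'k set" where
  "succ_omega D = {\<delta>\<in>D. D \<inter> {..<\<delta>} \<noteq> {} \<and> finite (D \<inter> {..<\<delta>})}"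

text \<open>D is an initial segment of C: D = C \<inter> beta for some ordinal beta
  (beta = kappa or larger corresponds to D = C)\<close>
definition sqsub :: "'k::wellorder set \<Rightarrow> 'k set \<Rightarrow> bool" where
  "sqsub D C \<longleftrightarrow> D = C \<or> (\<exists>\<beta>. D = C \<inter> {..<\<beta>})"

definition club_in :: "'k::wellorder set \<Rightarrow> 'k \<Rightarrow> bool" where
  "club_in C \<alpha> \<longleftrightarrow> C \<subseteq> {..<\<alpha>} \<and> sup_is C \<alpha>
     \<and> (\<forall>\<gamma><\<alpha>. (\<exists>\<beta>. \<beta> < \<gamma>) \<and> sup_is (C \<inter> {..<\<gamma>}) \<gamma> \<longrightarrow> \<gamma> \<in> C)"

definition club :: "'k::wellorder set \<Rightarrow> bool" where
  "club C \<longleftrightarrow> (\<forall>\<alpha>. \<exists>\<beta>\<in>C. \<alpha> < \<beta>)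
     \<and> (\<forall>\<gamma>. (\<exists>\<beta>. \<beta> < \<gamma>) \<and> sup_is (C \<inter> {..<\<gamma>}) \<gamma> \<longrightarrow> \<gamma> \<in> C)"

definition stationary :: "'k::wellorder set \<Rightarrow> bool" where
  "stationary S \<longleftrightarrow> (\<forall>C. club C \<longrightarrow> S \<inter> C \<noteq> {})"

definition cofinal :: "'k::wellorder set \<Rightarrow> bool" where
  "cofinal A \<longleftrightarrow> (\<forall>\<alpha>. \<exists>\<beta>\<in>A. \<alpha> < \<beta>)"

definition diamond :: "'k::wellorder itself \<Rightarrow> bool" where
  "diamond _ \<longleftrightarrow> (\<exists>A::'k \<Rightarrow> 'k set. (\<forall>\<alpha>. A \<alpha> \<subseteq> {..<\<alpha>})
      \<and> (\<forall>X. stationary {\<alpha>. X \<inter> {..<\<alpha>} = A \<alpha>}))"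

text \<open>P^-_14(kappa, R, 1, SS): the case mu = 1, so a sequence <A_i | i < 1> is a single
  cofinal set A_0, and "for all i < min{alpha, 1}" means "if alpha > 0".\<close>
definition P14_minus_mu1 :: "('k::wellorder set \<Rightarrow> 'k set \<Rightarrow> bool) \<Rightarrow> 'k set set \<Rightarrow> bool" where
  "P14_minus_mu1 R SS \<longleftrightarrow> (\<exists>C::'k \<Rightarrow> 'k set.
      (\<forall>\<alpha>. is_limit \<alpha> \<longrightarrow> club_in (C \<alpha>) \<alpha>)
    \<and> (\<forall>\<alpha> \<alpha>'. \<alpha>' \<in> acc (C \<alpha>) \<longrightarrow> R (C \<alpha>') (C \<alpha>))
    \<and> (\<forall>A S. cofinal A \<longrightarrow> S \<in> SS \<longrightarrow>
         stationary {\<alpha>\<in>S. (\<exists>i. i < \<alpha>) \<longrightarrow>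
            sup_is {\<beta>\<in>C \<alpha>. succ_omega {\<gamma>\<in>C \<alpha>. \<beta> \<le> \<gamma>} \<subseteq> A} \<alpha>}))"

definition P14_mu1 :: "('k::wellorder set \<Rightarrow> 'k set \<Rightarrow> bool) \<Rightarrow> 'k set set \<Rightarrow> bool" where
  "P14_mu1 R SS \<longleftrightarrow> P14_minus_mu1 R SS \<and> diamond TYPE('k)"

definition omega_k :: "'k::wellorder" where
  "omega_k = (LEAST \<alpha>. infinite {..<\<alpha>})"

text \<open>Nodes of ^{<kappa}kappa are partial maps with domain an ordinal alpha < kappa.\<close>
definition is_node :: "('k::wellorder \<rightharpoonup> 'k) \<Rightarrow> bool" where
  "is_node t \<longleftrightarrow> (\<exists>\<alpha>. dom t = {..<\<alpha>})"

definition level :: "('k::wellorder \<rightharpoonup> 'k) set \<Rightarrow> 'k \<Rightarrow> ('k \<rightharpoonup> 'k) set" where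
  "level T \<alpha> = {t\<in>T. dom t = {..<\<alpha>}}"

definition strict_ext :: "('k \<rightharpoonup> 'k) \<Rightarrow> ('k \<rightharpoonup> 'k) \<Rightarrow> bool" where
  "strict_ext s t \<longleftrightarrow> s \<subseteq>\<^sub>m t \<and> s \<noteq> t"

definition downward_closed_tree :: "('k::wellorder \<rightharpoonup> 'k) set \<Rightarrow> bool" where
  "downward_closed_tree T \<longleftrightarrow> (\<forall>t\<in>T. is_node t)
     \<and> (\<forall>t\<in>T. \<forall>s. is_node s \<and> strict_ext s t \<longrightarrow> s \<in> T)"

definition prolific :: "('k::wellorder \<rightharpoonup> 'k) set \<Rightarrow> bool" where
  "prolific T \<longleftrightarrow> (\<forall>\<alpha>. \<forall>x\<in>level T \<alpha>. \<forall>i. i < max omega_k \<alpha> \<longrightarrow> x(\<alpha> \<mapsto> i) \<in> T)"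

definition slim :: "('k::wellorder \<rightharpoonup> 'k) set \<Rightarrow> bool" where
  "slim T \<longleftrightarrow> (\<forall>\<alpha>. if finite {..<\<alpha>} then countable (level T \<alpha>)
                     else level T \<alpha> \<lesssim> {..<\<alpha>})"

definition tree_chain :: "('k \<rightharpoonup> 'k) set \<Rightarrow> bool" where
  "tree_chain B \<longleftrightarrow> (\<forall>s\<in>B. \<forall>t\<in>B. s \<subseteq>\<^sub>m t \<or> t \<subseteq>\<^sub>m s)"

definition cofinal_branch :: "('k::wellorder \<rightharpoonup> 'k) set \<Rightarrow> ('k \<rightharpoonup> 'k) set \<Rightarrow> bool" where
  "cofinal_branch T B \<longleftrightarrow> B \<subseteq> T \<and> tree_chain B
     \<and> (\<forall>t\<in>T. (\<forall>s\<in>B. s \<subseteq>\<^sub>m t \<or> t \<subseteq>\<^sub>m s) \<longrightarrow> t \<in> B)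
     \<and> (\<forall>\<alpha>. B \<inter> level T \<alpha> \<noteq> {})"

definition tree_antichain :: "('k \<rightharpoonup> 'k) set \<Rightarrow> bool" where
  "tree_antichain A \<longleftrightarrow> (\<forall>s\<in>A. \<forall>t\<in>A. s \<noteq> t \<longrightarrow> \<not> s \<subseteq>\<^sub>m t \<and> \<not> t \<subseteq>\<^sub>m s)"

definition souslin :: "('k::wellorder \<rightharpoonup> 'k) set \<Rightarrow> bool" where
  "souslin T \<longleftrightarrow> (\<forall>\<alpha>. level T \<alpha> \<noteq> {})
     \<and> (\<forall>\<alpha>. level T \<alpha> \<prec> (UNIV::'k set))
     \<and> \<not> (\<exists>B. cofinal_branch T B)
     \<and> \<not> (\<exists>A\<subseteq>T. tree_antichain A \<and> A \<approx> (UNIV::'k set))"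

definition Ffin :: "nat set set" where
  "Ffin = {Z. finite (UNIV - Z)}"

definition ascent_path :: "('k::wellorder \<rightharpoonup> 'k) set \<Rightarrow> ('k \<Rightarrow> nat \<Rightarrow> ('k \<rightharpoonup> 'k)) \<Rightarrow> bool" where
  "ascent_path T f \<longleftrightarrow> (\<forall>\<alpha> n. f \<alpha> n \<in> level T \<alpha>)
     \<and> (\<forall>\<alpha> \<beta>. \<alpha> < \<beta> \<longrightarrow> {n. strict_ext (f \<alpha> n) (f \<beta> n)} \<in> Ffin)"

definition injective_ascent :: "('k \<Rightarrow> nat \<Rightarrow> ('k \<rightharpoonup> 'k)) \<Rightarrow> bool" where
  "injective_ascent f \<longleftrightarrow> (\<exists>\<alpha>. \<exists>I\<in>Ffin. inj_on (f \<alpha>) I)"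

end

theory Submission
  imports Defs
begin

text \<open>Levels are built by recursion. At a limit \<open>\<alpha>\<close>, every node \<open>x\<close> below \<open>\<alpha>\<close> and every \<open>n < \<omega>\<close>
  determine a cofinal branch climbing along \<open>C \<alpha>\<close>. At the \<open>k\<close>-th point after the last accumulation
  point, threads with \<open>n > k\<close> follow the ascent path, while threads with \<open>n \<le> k\<close> pass through the set
  guessed by diamond. All but finitely many threads follow the path at any given point, so the threads
  started at the root prolong the ascent path; coherence of the \<open>C \<alpha>\<close> keeps the branches inside the
  tree at accumulation points. If a whole \<omega>-block of consecutive points of \<open>C \<alpha>\<close> consists of
  correct guesses, every thread meets the guessed dense set at some point of the block. Hence each
  dense set is met below some level by all nodes of that level, which excludes cofinal branches and
  antichains of size \<kappa>.\<close>

section \<open>Regular uncountable cardinals as well-ordered types\<close>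

definition sc :: "'k::wellorder \<Rightarrow> 'k" where
  "sc \<alpha> = (LEAST \<beta>. \<alpha> < \<beta>)"

lemma infinite_times_lepoll:
  assumes "infinite C" "A \<lesssim> C" "B \<lesssim> C"
  shows "A \<times> B \<lesssim> C"
proof -
  have "C \<times> C \<approx> C"
    using assms(1) card_of_Times_same_infinite eqpoll_iff_card_of_ordIso by blast
  then show ?thesis
    using lepoll_trans2 times_lepoll_mono[OF assms(2,3)] by blast
qed

lemma infinite_UN_lepoll:
  assumes "infinite C" "I \<lesssim> C" "\<And>i. i \<in> I \<Longrightarrow> B i \<lesssim> C"
  shows "(\<Union>i\<in>I. B i) \<lesssim> C"
proof -
  have "(\<Union>i\<in>I. B i) = snd ` Sigma I B" by force
  then have "(\<Union>i\<in>I. B i) \<lesssim> Sigma I B" by (simp add: image_lepoll)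
  also have "Sigma I B \<lesssim> I \<times> C"
    using assms(3) by (intro Sigma_lepoll_mono) auto
  also have "I \<times> C \<lesssim> C"
    using assms(1,2) by (intro infinite_times_lepoll) auto
  finally show ?thesis .
qed

lemma uncountable_lesspoll:
  assumes "countable A" "\<not> countable B"
  shows "A \<prec> B"
proof -
  have "infinite B" using assms(2) countable_finite by blast
  then have "A \<lesssim> B"
    using assms(1) by (meson countable_def infinite_le_lepoll lepoll_def lepoll_trans subset_UNIV)
  then show ?thesis
    using assms countable_eqpoll eqpoll_sym lesspoll_def by blast
qed

locale reg_card =
  fixes ty :: "'k::wellorder itself"
  assumes reg: "reg_uncountable_cardinal TYPE('k)"
begin

lemma segment_lesspoll: "{..<\<alpha>::'k} \<prec> (UNIV::'k set)"
  and uncountable_UNIV: "\<not> countable (UNIV::'k set)"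
  and bounded: "A \<prec> (UNIV::'k set) \<Longrightarrow> \<exists>\<alpha>. A \<subseteq> {..<\<alpha>::'k}"
  using reg unfolding reg_uncountable_cardinal_def by auto

lemma bounded_image: "S \<prec> (UNIV::'k set) \<Longrightarrow> \<exists>\<alpha>. g ` S \<subseteq> {..<\<alpha>::'k}"
  by (intro bounded lesspoll_trans1[OF image_lepoll])

lemma bounded_countable: "countable A \<Longrightarrow> \<exists>\<alpha>. A \<subseteq> {..<\<alpha>::'k}"
  by (intro bounded uncountable_lesspoll uncountable_UNIV)

lemma ex_greater: "\<exists>\<beta>. (\<alpha>::'k) < \<beta>"
  using bounded_countable[of "{\<alpha>}"] by auto

lemma sc_greater: "(\<alpha>::'k) < sc \<alpha>"
  unfolding sc_def by (rule LeastI_ex[OF ex_greater])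

lemma less_sc_iff: "(\<gamma>::'k) < sc \<alpha> \<longleftrightarrow> \<gamma> \<le> \<alpha>"
  by (metis Least_le leD leI order_le_less_trans sc_def sc_greater)

lemma lessThan_sc: "{..<sc \<alpha>} = {..(\<alpha>::'k)}"
  by (auto simp: less_sc_iff)

lemma sc_inj: "sc \<alpha> = sc \<beta> \<longleftrightarrow> (\<alpha>::'k) = \<beta>"
  by (metis less_sc_iff order_antisym order_refl)

lemma not_limit_sc: "\<not> is_limit (sc (\<alpha>::'k))"
  unfolding is_limit_def by (meson leD less_sc_iff sc_greater)

lemma ordinal_cases [case_names zero succ limit]:
  obtains "\<And>\<beta>. \<not> \<beta> < (\<alpha>::'k)" | \<gamma> where "\<alpha> = sc \<gamma>" | "is_limit \<alpha>"
proof (cases "is_limit \<alpha> \<or> (\<forall>\<beta>. \<not> \<beta> < \<alpha>)")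
  case False
  then obtain \<gamma> where \<gamma>: "\<gamma> < \<alpha>" "\<forall>\<delta>. \<gamma> < \<delta> \<longrightarrow> \<not> \<delta> < \<alpha>"
    unfolding is_limit_def by blast
  then have "\<alpha> = sc \<gamma>"
    by (metis less_sc_iff linorder_neqE order_refl sc_greater leD)
  then show ?thesis using that by blast
qed (use that in auto)

text \<open>If every segment were finite, its cardinality would embed the uncountable
  \<open>'k\<close> into the naturals. This is what makes the LEAST in \<open>omega_k\<close>
  meaningful.\<close>

lemma ex_infinite_segment: "\<exists>\<alpha>::'k. infinite {..<\<alpha>}"
proof (rule ccontr)
  assume "\<not> ?thesis"
  then have fin: "finite {..<\<alpha>}" for \<alpha> :: 'k by auto
  have "inj (\<lambda>\<alpha>::'k. card {..<\<alpha>})"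
  proof (rule linorder_injI)
    fix x y :: 'k assume "x < y"
    then have "{..<x} \<subset> {..<y}" by auto
    then show "card {..<x} \<noteq> card {..<y}"
      using psubset_card_mono[OF fin] by (metis less_irrefl)
  qed
  then have "countable (UNIV::'k set)" by (rule countableI)
  then show False using uncountable_UNIV by blast
qed

lemma infinite_omega_k: "infinite {..<omega_k::'k}"
  unfolding omega_k_def by (rule LeastI_ex[OF ex_infinite_segment])

lemma finite_below_omega_k: "(\<alpha>::'k) < omega_k \<longleftrightarrow> finite {..<\<alpha>}"
proof
  assume "\<alpha> < omega_k"
  then show "finite {..<\<alpha>}" unfolding omega_k_def using not_less_Least by blast
next
  assume "finite {..<\<alpha>}"
  then show "\<alpha> < omega_k"
    using infinite_omega_k by (meson finite_subset lessThan_subset_iff not_less)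
qed

lemma countable_omega_k: "countable {..<omega_k::'k}"
proof -
  have "inj_on (\<lambda>\<alpha>::'k. card {..<\<alpha>}) {..<omega_k}"
  proof (rule linorder_inj_onI')
    fix x y :: 'k assume "x < y" "y \<in> {..<omega_k}"
    then have "{..<x} \<subset> {..<y}" "finite {..<y}" by (auto simp: finite_below_omega_k)
    then show "card {..<x} \<noteq> card {..<y}"
      using psubset_card_mono by (metis less_irrefl)
  qed
  then show ?thesis by (rule countableI)
qed

lemma infinite_max_omega_k: "infinite {..<max omega_k (\<alpha>::'k)}"
  using infinite_omega_k by (meson finite_subset lessThan_subset_iff max.cobounded1)

text \<open>Closure points are unbounded because the union of an increasing \<omega>-sequence of ordinals below
  \<kappa> is again below \<kappa>.\<close>

lemma club_closure_points: "club {\<beta>. (\<delta>::'k) < \<beta> \<and> (\<forall>\<gamma><\<beta>. g \<gamma> < \<beta>)}"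
  unfolding club_def
proof (intro conjI allI impI)
  fix \<alpha> :: 'k
  have "\<exists>b. a < b \<and> (\<forall>\<gamma><a. g \<gamma> < b)" for a
  proof -
    obtain b1 where b1: "g ` {..<a} \<subseteq> {..<b1}" using bounded_image[OF segment_lesspoll] by blast
    obtain b where "max a b1 < b" using ex_greater by blast
    then show ?thesis using b1 by (intro exI[of _ b]) (auto simp: image_subset_iff intro: less_trans)
  qed
  then obtain h where h: "\<And>a. a < h a" "\<And>a \<gamma>. \<gamma> < a \<Longrightarrow> g \<gamma> < h a" by metis
  \<comment> \<open>\<open>b\<close> is the supremum of the \<omega>-sequence \<open>a\<close>, so
    any \<gamma> below \<open>b\<close> lies at or below some \<open>a n\<close>. One more iterate
    passes \<gamma> strictly, and the next passes \<open>g \<gamma>\<close>.\<close>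
  define a where "a n = (h ^^ n) (max \<alpha> \<delta>)" for n
  define b where "b = (LEAST b. \<forall>n. a n < b)"
  have "\<exists>b. \<forall>n. a n < b" using bounded_countable[of "range a"] by auto
  then have ab: "a n < b" for n unfolding b_def by (rule LeastI2_ex) auto
  have le: "\<exists>n. \<gamma> \<le> a n" if "\<gamma> < b" for \<gamma>
    using not_less_Least[OF that[unfolded b_def]] by (auto simp: not_less)
  have "g \<gamma> < b" if \<gamma>: "\<gamma> < b" for \<gamma>
  proof -
    obtain n where "\<gamma> \<le> a n" using le[OF \<gamma>] by blast
    then have "\<gamma> < a (Suc n)" using h(1)[of "a n"] by (simp add: a_def)
    then have "g \<gamma> < a (Suc (Suc n))" using h(2) by (simp add: a_def)
    then show ?thesis using ab less_trans by blast
  qed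
  moreover have "max \<alpha> \<delta> < b" using ab[of 0] by (simp add: a_def)
  ultimately show "\<exists>\<beta>\<in>{\<beta>. \<delta> < \<beta> \<and> (\<forall>\<gamma><\<beta>. g \<gamma> < \<beta>)}. \<alpha> < \<beta>"
    by (intro bexI[of _ b]) auto
next
  fix \<gamma>
  let ?E = "{\<beta>. \<delta> < \<beta> \<and> (\<forall>\<gamma><\<beta>. g \<gamma> < \<beta>)}"
  assume *: "(\<exists>\<beta>. \<beta> < \<gamma>) \<and> sup_is (?E \<inter> {..<\<gamma>}) \<gamma>"
  then have s: "\<exists>x\<in>?E \<inter> {..<\<gamma>}. \<epsilon> < x" if "\<epsilon> < \<gamma>" for \<epsilon>
    using that unfolding sup_is_def by blast
  have "\<delta> < \<gamma>" using * s by fastforce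
  moreover have "g \<epsilon> < \<gamma>" if "\<epsilon> < \<gamma>" for \<epsilon> using s[OF that] by fastforce
  ultimately show "\<gamma> \<in> ?E" by blast
qed

end

section \<open>Unions of chains of partial maps\<close>

text \<open>The union of the graphs. The choice by SOME matters only if two members of
  \<open>S\<close> disagree, which a chain excludes (\<open>munion_upper\<close>). A total operation
  is convenient because the recursion forms the union before the chain property is known.\<close>

definition munion :: "('a \<rightharpoonup> 'b) set \<Rightarrow> ('a \<rightharpoonup> 'b)" where
  "munion S = (\<lambda>\<xi>. if \<exists>t\<in>S. \<xi> \<in> dom t then (SOME t. t \<in> S \<and> \<xi> \<in> dom t) \<xi> else None)"

lemma munion_upper:
  assumes "tree_chain S" "t \<in> S"
  shows "t \<subseteq>\<^sub>m munion S"
  unfolding map_le_def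
proof
  fix \<xi> assume \<xi>: "\<xi> \<in> dom t"
  define u where "u = (SOME t. t \<in> S \<and> \<xi> \<in> dom t)"
  have u: "u \<in> S \<and> \<xi> \<in> dom u" unfolding u_def using assms(2) \<xi> by (intro someI_ex[of "\<lambda>t. t \<in> S \<and> \<xi> \<in> dom t"]) auto
  then have "t \<subseteq>\<^sub>m u \<or> u \<subseteq>\<^sub>m t" using assms unfolding tree_chain_def by blast
  then have "t \<xi> = u \<xi>" using \<xi> u by (metis map_le_def)
  moreover have "munion S \<xi> = u \<xi>" using assms(2) \<xi> by (auto simp: munion_def u_def)
  ultimately show "t \<xi> = munion S \<xi>" by simp
qed

lemma dom_munion:
  assumes "tree_chain S"
  shows "dom (munion S) = (\<Union>t\<in>S. dom t)"
proof
  show "dom (munion S) \<subseteq> (\<Union>t\<in>S. dom t)" by (auto simp: munion_def split: if_splits)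
  show "(\<Union>t\<in>S. dom t) \<subseteq> dom (munion S)"
    using munion_upper[OF assms] by (meson UN_least map_le_implies_dom_le)
qed

lemma map_le_restrict: "s \<subseteq>\<^sub>m t \<Longrightarrow> dom s = D \<Longrightarrow> t |` D = s"
  by (rule ext) (force simp: map_le_def restrict_map_def dom_def)

lemma map_le_dom_eq: "s \<subseteq>\<^sub>m t \<Longrightarrow> dom s = dom t \<Longrightarrow> s = t"
  by (metis map_le_antisym map_le_def)

lemma restrict_map_le: "t |` D \<subseteq>\<^sub>m t"
  by (auto simp: map_le_def restrict_map_def)

lemma restrict_mono: "s \<subseteq>\<^sub>m t \<Longrightarrow> dom s \<subseteq> D \<Longrightarrow> s \<subseteq>\<^sub>m t |` D"
  by (auto simp: map_le_def restrict_map_def)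

lemma munion_greatest:
  assumes "tree_chain S" "m \<in> S" "\<And>t. t \<in> S \<Longrightarrow> t \<subseteq>\<^sub>m m"
  shows "munion S = m"
proof (rule map_le_dom_eq[symmetric])
  show "m \<subseteq>\<^sub>m munion S" using assms by (blast intro: munion_upper)
  show "dom m = dom (munion S)"
    unfolding dom_munion[OF assms(1)] using assms(2,3) map_le_implies_dom_le by blast
qed

section \<open>The recursive construction\<close>

text \<open>The distance of \<open>\<beta>\<close> from the last accumulation point of \<open>D\<close> up to \<open>\<beta>\<close>.\<close>

definition fin_rank :: "'k::wellorder set \<Rightarrow> 'k \<Rightarrow> nat" where
  "fin_rank D \<beta> = card {\<gamma>\<in>D. \<gamma> < \<beta> \<and> finite (D \<inter> {\<gamma>..<\<beta>})}"

lemma fin_rank_cong: "D \<inter> {..<\<beta>} = D' \<inter> {..<\<beta>} \<Longrightarrow> fin_rank D \<beta> = fin_rank D' \<beta>"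
proof -
  assume eq: "D \<inter> {..<\<beta>} = D' \<inter> {..<\<beta>}"
  have "{\<gamma>..<\<beta>} = {..<\<beta>} \<inter> {\<gamma>..}" for \<gamma> by auto
  then have "D \<inter> {\<gamma>..<\<beta>} = D' \<inter> {\<gamma>..<\<beta>}" for \<gamma> using eq by (metis Int_assoc)
  moreover have "\<gamma> \<in> D \<and> \<gamma> < \<beta> \<longleftrightarrow> \<gamma> \<in> D' \<and> \<gamma> < \<beta>" for \<gamma>
    using eq by (metis IntE IntI lessThan_iff)
  ultimately have "{\<gamma>\<in>D. \<gamma> < \<beta> \<and> finite (D \<inter> {\<gamma>..<\<beta>})} = {\<gamma>\<in>D'. \<gamma> < \<beta> \<and> finite (D' \<inter> {\<gamma>..<\<beta>})}"
    by (intro Collect_cong) (metis (lifting))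
  then show ?thesis unfolding fin_rank_def by simp
qed

text \<open>For the least element \<open>m\<close> of the set, everything lies in
  \<open>D \<inter> {m..<\<beta>}\<close>, which is finite because \<open>m\<close> belongs to the
  set. Hence \<open>card\<close> in \<open>fin_rank\<close> is a true count and never the default
  value of an infinite set.\<close>

lemma finite_fin_rank:
  fixes \<beta> :: "'k::wellorder"
  shows "finite {\<gamma>\<in>D. \<gamma> < \<beta> \<and> finite (D \<inter> {\<gamma>..<\<beta>})}" (is "finite ?K")
proof (cases "?K = {}")
  case False
  then obtain m where "m \<in> ?K" "\<And>\<gamma>. \<gamma> \<in> ?K \<Longrightarrow> m \<le> \<gamma>"
    using exists_least_iff[of "\<lambda>\<gamma>. \<gamma> \<in> ?K"] by (meson ex_in_conv not_less)
  then have "finite (D \<inter> {m..<\<beta>})" "?K \<subseteq> D \<inter> {m..<\<beta>}" by auto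
  then show ?thesis using finite_subset by blast
next
  case True
  then show ?thesis by (metis finite.emptyI)
qed

text \<open>Every point of a finite final part of \<open>D\<close> below \<beta> is counted by the
  rank. \<open>sealing\<close> uses this to make the rank at least a given thread number.\<close>

lemma fin_rank_ge: "finite (D \<inter> {\<beta>1..<\<beta>}) \<Longrightarrow> card (D \<inter> {\<beta>1..<\<beta>}) \<le> fin_rank D \<beta>"
  unfolding fin_rank_def
proof (rule card_mono[OF finite_fin_rank], rule subsetI)
  fix \<gamma> assume "finite (D \<inter> {\<beta>1..<\<beta>})" and \<gamma>: "\<gamma> \<in> D \<inter> {\<beta>1..<\<beta>}"
  moreover have "D \<inter> {\<gamma>..<\<beta>} \<subseteq> D \<inter> {\<beta>1..<\<beta>}" using \<gamma> by auto
  ultimately have "finite (D \<inter> {\<gamma>..<\<beta>})" by (metis finite_subset)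
  with \<gamma> show "\<gamma> \<in> {\<gamma> \<in> D. \<gamma> < \<beta> \<and> finite (D \<inter> {\<gamma>..<\<beta>})}" by auto
qed

text \<open>Diamond guesses subsets of \<kappa>, so nodes are coded by ordinals. A level is coded by a choice depending
  only on that level, which makes the guesses available during the recursion.\<close>

definition pair_code :: "'k::wellorder \<times> 'k \<Rightarrow> 'k" where
  "pair_code = (SOME p. inj p)"

type_synonym 'k levels = "'k \<Rightarrow> ('k \<rightharpoonup> 'k) set \<times> (nat \<Rightarrow> 'k \<rightharpoonup> 'k)"

definition code :: "'k::wellorder levels \<Rightarrow> 'k \<Rightarrow> ('k \<rightharpoonup> 'k) \<Rightarrow> 'k" where
  "code L \<beta> t = pair_code (\<beta>, (SOME g. inj_on g (fst (L \<beta>))) t)"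

definition guessed :: "('k::wellorder \<Rightarrow> 'k set) \<Rightarrow> 'k levels \<Rightarrow> 'k \<Rightarrow> ('k \<rightharpoonup> 'k) set" where
  "guessed A L \<beta> = {t. \<exists>\<gamma><\<beta>. t \<in> fst (L \<gamma>) \<and> code L \<gamma> t \<in> A \<beta>}"

text \<open>Three choices in order of priority: the path, a node above the guess, any node. For
  fixed \<open>k\<close> the first is open to all but finitely many \<open>n\<close>; for fixed
  \<open>n\<close> it is closed as soon as \<open>k \<ge> n\<close>. The test against
  \<open>snd (L \<beta>) n\<close> keeps the branch increasing when it has left the path.\<close>

definition extension :: "('k::wellorder \<Rightarrow> 'k set) \<Rightarrow> 'k levels \<Rightarrow> 'k \<Rightarrow> nat \<Rightarrow> nat \<Rightarrow> ('k \<rightharpoonup> 'k) \<Rightarrow> ('k \<rightharpoonup> 'k)" where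
  "extension A L \<beta> n k s =
    (if k < n \<and> s \<subseteq>\<^sub>m snd (L \<beta>) n then snd (L \<beta>) n
     else if \<exists>t\<in>fst (L \<beta>). s \<subseteq>\<^sub>m t \<and> (\<exists>w\<in>guessed A L \<beta>. w \<subseteq>\<^sub>m t)
     then SOME t. t \<in> fst (L \<beta>) \<and> s \<subseteq>\<^sub>m t \<and> (\<exists>w\<in>guessed A L \<beta>. w \<subseteq>\<^sub>m t)
     else SOME t. t \<in> fst (L \<beta>) \<and> s \<subseteq>\<^sub>m t)"

text \<open>As long as \<beta> stays inside the domain of \<open>x\<close> the values are
  restrictions of \<open>x\<close>, so a thread may start at a node of any height. Inserting
  \<open>x\<close> into the union forces the first point of \<open>D\<close> beyond that domain to
  extend \<open>x\<close> itself.\<close>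

definition thread :: "('k::wellorder \<Rightarrow> 'k set) \<Rightarrow> 'k levels \<Rightarrow> 'k set \<Rightarrow> ('k \<rightharpoonup> 'k) \<Rightarrow> nat \<Rightarrow> 'k \<Rightarrow> ('k \<rightharpoonup> 'k)" where
  "thread A L D x n = wfrec {(\<gamma>, \<beta>). \<gamma> < \<beta>} (\<lambda>h \<beta>.
     if {..<\<beta>} \<subseteq> dom x then x |` {..<\<beta>}
     else extension A L \<beta> n (fin_rank D \<beta>) (munion (insert x (h ` (D \<inter> {..<\<beta>})))))"

definition thread_union :: "('k::wellorder \<Rightarrow> 'k set) \<Rightarrow> 'k levels \<Rightarrow> 'k set \<Rightarrow> ('k \<rightharpoonup> 'k) \<Rightarrow> nat \<Rightarrow> ('k \<rightharpoonup> 'k)" where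
  "thread_union A L D x n = munion (insert x (thread A L D x n ` D))"

section \<open>Locality of the threads\<close>

lemma thread_unfold:
  "thread A L D x n \<beta> = (if {..<\<beta>} \<subseteq> dom x then x |` {..<\<beta>}
     else extension A L \<beta> n (fin_rank D \<beta>) (munion (insert x (thread A L D x n ` (D \<inter> {..<\<beta>})))))"
proof -
  have "(cut (thread A L D x n) {(\<gamma>, \<beta>). \<gamma> < \<beta>} \<beta>) ` (D \<inter> {..<\<beta>}) = thread A L D x n ` (D \<inter> {..<\<beta>})"
    by (rule image_cong) (auto simp: cut_apply)
  with def_wfrec[OF thread_def[of A L D x n, THEN eq_reflection] wf, of \<beta>]
  show ?thesis by (simp only:)
qed

lemma guessed_cong:
  assumes "\<And>\<gamma>. \<gamma> < \<beta> \<Longrightarrow> L \<gamma> = L' \<gamma>"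
  shows "guessed A L \<beta> = guessed A L' \<beta>"
  using assms unfolding guessed_def code_def by (intro Collect_cong ex_cong1) auto

lemma extension_cong:
  assumes "\<And>\<gamma>. \<gamma> \<le> \<beta> \<Longrightarrow> L \<gamma> = L' \<gamma>"
  shows "extension A L \<beta> n k s = extension A L' \<beta> n k s"
proof -
  have "guessed A L \<beta> = guessed A L' \<beta>" by (intro guessed_cong assms less_imp_le)
  moreover have "L \<beta> = L' \<beta>" by (simp add: assms)
  ultimately show ?thesis by (simp only: extension_def)
qed

text \<open>A value at \<beta> consults \<open>D\<close> only below \<beta> and levels only up to
  \<beta>. Independence of later levels legitimates the recursion for \<open>L\<close>; independence
  of later points of \<open>D\<close> lets coherence identify threads in
  \<open>S_acc\<close>.\<close>

lemma thread_cong: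
  assumes "\<And>\<gamma>. \<gamma> \<le> \<beta> \<Longrightarrow> L \<gamma> = L' \<gamma>" "D \<inter> {..<\<beta>} = D' \<inter> {..<\<beta>}"
  shows "thread A L D x n \<beta> = thread A L' D' x n \<beta>"
  using assms
proof (induction \<beta> rule: less_induct)
  case (less \<beta>)
  have "thread A L D x n ` (D \<inter> {..<\<beta>}) = thread A L' D' x n ` (D' \<inter> {..<\<beta>})"
  proof (rule image_cong[OF less.prems(2)])
    fix \<gamma> assume "\<gamma> \<in> D' \<inter> {..<\<beta>}"
    then have "\<gamma> < \<beta>" by simp
    then have "{..<\<gamma>} = {..<\<beta>} \<inter> {..<\<gamma>}" by auto
    then have "D \<inter> {..<\<gamma>} = D' \<inter> {..<\<gamma>}" using less.prems(2) by (metis Int_assoc)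
    then show "thread A L D x n \<gamma> = thread A L' D' x n \<gamma>"
      using \<open>\<gamma> < \<beta>\<close> less.prems(1) by (intro less.IH) auto
  qed
  then show ?case
    using fin_rank_cong[OF less.prems(2)] extension_cong[of \<beta> L L', OF less.prems(1)]
    by (simp only: thread_unfold[of A L D x n \<beta>] thread_unfold[of A L' D' x n \<beta>])
qed

lemma lim_cong:
  assumes "\<And>\<gamma>. \<gamma> < \<alpha> \<Longrightarrow> L \<gamma> = L' \<gamma>" "D \<subseteq> {..<\<alpha>}"
  shows "thread_union A L D x n = thread_union A L' D x n"
proof -
  have "thread A L D x n ` D = thread A L' D x n ` D"
    using assms by (intro image_cong refl thread_cong) (auto intro: le_less_trans)
  then show ?thesis unfolding thread_union_def by simp
qed

text \<open>Appending \<open>e n\<close> rather than \<open>0\<close> to the \<open>n\<close>-th node at successor levels makes the path injective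
  at level 1.\<close>

definition step :: "('k::wellorder \<Rightarrow> 'k set) \<Rightarrow> ('k \<Rightarrow> 'k set) \<Rightarrow> (nat \<Rightarrow> 'k) \<Rightarrow> 'k levels \<Rightarrow> 'k
    \<Rightarrow> ('k \<rightharpoonup> 'k) set \<times> (nat \<Rightarrow> 'k \<rightharpoonup> 'k)" where
  "step A C e L \<alpha> =
    (if is_limit \<alpha> then
       ({thread_union A L (C \<alpha>) x n | x n. \<exists>\<beta><\<alpha>. x \<in> fst (L \<beta>)}, thread_union A L (C \<alpha>) Map.empty)
     else if \<exists>\<gamma><\<alpha>. \<alpha> = sc \<gamma> then
       let \<gamma> = THE \<gamma>. \<gamma> < \<alpha> \<and> \<alpha> = sc \<gamma> in
         ({x(\<gamma> \<mapsto> i) | x i. x \<in> fst (L \<gamma>) \<and> i < max omega_k \<gamma>}, \<lambda>n. (snd (L \<gamma>) n)(\<gamma> \<mapsto> e n))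
     else ({Map.empty}, \<lambda>n. Map.empty))"

section \<open>The levels and the path for a fixed proxy sequence and diamond sequence\<close>

locale construction = reg_card ty for ty :: "'k::wellorder itself" +
  fixes C A :: "'k \<Rightarrow> 'k set"
  assumes clubC: "is_limit \<alpha> \<Longrightarrow> club_in (C \<alpha>) \<alpha>"
    and coherent: "\<alpha>' \<in> Defs.acc (C \<alpha>) \<Longrightarrow> sqsub (C \<alpha>') (C \<alpha>)"
    and guess: "cofinal B \<Longrightarrow> stationary {\<alpha>. (\<exists>i. i < \<alpha>) \<longrightarrow>
            sup_is {\<beta>\<in>C \<alpha>. succ_omega {\<gamma>\<in>C \<alpha>. \<beta> \<le> \<gamma>} \<subseteq> B} \<alpha>}"
    and dia: "stationary {\<alpha>. X \<inter> {..<\<alpha>} = A \<alpha>}"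
begin

definition e :: "nat \<Rightarrow> 'k" where
  "e = (SOME e. inj e \<and> range e \<subseteq> {..<omega_k})"

lemma e: "inj e" "e n < omega_k"
proof -
  have "inj e \<and> range e \<subseteq> {..<omega_k}"
    unfolding e_def by (rule someI_ex[OF infinite_countable_subset[OF infinite_omega_k]])
  then show "inj e" "e n < omega_k" by auto
qed

definition L :: "'k levels" where
  "L = wfrec {(\<gamma>, \<beta>). \<gamma> < \<beta>} (step A C e)"

definition T :: "'k \<Rightarrow> ('k \<rightharpoonup> 'k) set" where "T \<alpha> = fst (L \<alpha>)"

definition f :: "'k \<Rightarrow> nat \<Rightarrow> ('k \<rightharpoonup> 'k)" where "f \<alpha> = snd (L \<alpha>)"

text \<open>The recursor hands \<open>step\<close> a family cut off at \<alpha>, and no clause looks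
  further: zero consults no level, a successor only its predecessor, and a limit only levels below
  \<alpha>, by \<open>lim_cong\<close>.\<close>

lemma L_unfold: "L \<alpha> = step A C e L \<alpha>"
proof -
  let ?R = "{(\<gamma>, \<beta>). \<gamma> < \<beta>} :: ('k \<times> 'k) set"
  let ?c = "cut L ?R \<alpha>"
  have c: "?c \<gamma> = L \<gamma>" if "\<gamma> < \<alpha>" for \<gamma> using that by (simp add: cut_apply)
  have "L \<alpha> = step A C e ?c \<alpha>" by (rule def_wfrec[OF L_def[THEN eq_reflection] wf])
  also have "\<dots> = step A C e L \<alpha>"
  proof (cases \<alpha> rule: ordinal_cases)
    case zero
    then show ?thesis by (auto simp: step_def is_limit_def)
  next
    case (succ \<gamma>)
    then have "(THE \<gamma>. \<gamma> < \<alpha> \<and> \<alpha> = sc \<gamma>) = \<gamma>"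
      by (intro the_equality) (simp_all add: sc_inj sc_greater)
    moreover have "cut L ?R (sc \<gamma>) \<gamma> = L \<gamma>" by (simp add: cut_apply sc_greater)
    moreover have "\<exists>\<gamma>'<sc \<gamma>. sc \<gamma> = sc \<gamma>'" using sc_greater by blast
    ultimately show ?thesis using succ by (simp add: step_def not_limit_sc Let_def)
  next
    case limit
    then have "C \<alpha> \<subseteq> {..<\<alpha>}" using clubC[OF limit] by (simp add: club_in_def)
    then have l: "thread_union A ?c (C \<alpha>) x n = thread_union A L (C \<alpha>) x n" for x n
      by (intro lim_cong[of \<alpha> ?c L]) (rule c)
    moreover from l have "thread_union A ?c (C \<alpha>) Map.empty = thread_union A L (C \<alpha>) Map.empty" by (rule HOL.ext)
    moreover have "(\<exists>\<beta><\<alpha>. x \<in> fst (?c \<beta>)) \<longleftrightarrow> (\<exists>\<beta><\<alpha>. x \<in> fst (L \<beta>))" for x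
      by (metis c)
    ultimately show ?thesis using limit by (simp add: step_def)
  qed
  finally show ?thesis .
qed

lemma level_zero:
  assumes "\<And>\<beta>. \<not> \<beta> < \<alpha>"
  shows "T \<alpha> = {Map.empty}" "f \<alpha> n = Map.empty"
proof -
  have "L \<alpha> = ({Map.empty}, \<lambda>n. Map.empty)"
    using L_unfold[of \<alpha>] assms by (simp add: step_def is_limit_def)
  then show "T \<alpha> = {Map.empty}" "f \<alpha> n = Map.empty" by (simp_all add: T_def f_def)
qed

lemma level_sc:
  shows "T (sc \<gamma>) = {x(\<gamma> \<mapsto> i) | x i. x \<in> T \<gamma> \<and> i < max omega_k \<gamma>}"
    and "f (sc \<gamma>) n = (f \<gamma> n)(\<gamma> \<mapsto> e n)"
proof -
  have the: "(THE \<delta>. \<delta> < sc \<gamma> \<and> sc \<gamma> = sc \<delta>) = \<gamma>"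
    by (intro the_equality) (simp_all add: sc_inj sc_greater)
  have "\<exists>\<delta><sc \<gamma>. sc \<gamma> = sc \<delta>" using sc_greater by blast
  then have "step A C e L (sc \<gamma>) =
      ({x(\<gamma> \<mapsto> i) | x i. x \<in> fst (L \<gamma>) \<and> i < max omega_k \<gamma>}, \<lambda>n. (snd (L \<gamma>) n)(\<gamma> \<mapsto> e n))"
    by (simp add: step_def not_limit_sc the Let_def)
  with L_unfold[of "sc \<gamma>"]
  have "L (sc \<gamma>) =
      ({x(\<gamma> \<mapsto> i) | x i. x \<in> fst (L \<gamma>) \<and> i < max omega_k \<gamma>}, \<lambda>n. (snd (L \<gamma>) n)(\<gamma> \<mapsto> e n))"
    by (rule trans)
  then show "T (sc \<gamma>) = {x(\<gamma> \<mapsto> i) | x i. x \<in> T \<gamma> \<and> i < max omega_k \<gamma>}"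
    and "f (sc \<gamma>) n = (f \<gamma> n)(\<gamma> \<mapsto> e n)"
    by (simp_all add: T_def f_def)
qed

lemma level_limit:
  assumes "is_limit \<alpha>"
  shows "T \<alpha> = {thread_union A L (C \<alpha>) x n | x n. \<exists>\<beta><\<alpha>. x \<in> T \<beta>}" "f \<alpha> n = thread_union A L (C \<alpha>) Map.empty n"
proof -
  have "step A C e L \<alpha> = ({thread_union A L (C \<alpha>) x n | x n. \<exists>\<beta><\<alpha>. x \<in> fst (L \<beta>)}, thread_union A L (C \<alpha>) Map.empty)"
    using assms by (simp add: step_def)
  with L_unfold[of \<alpha>]
  have "L \<alpha> = ({thread_union A L (C \<alpha>) x n | x n. \<exists>\<beta><\<alpha>. x \<in> fst (L \<beta>)}, thread_union A L (C \<alpha>) Map.empty)"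
    by (rule trans)
  then show "T \<alpha> = {thread_union A L (C \<alpha>) x n | x n. \<exists>\<beta><\<alpha>. x \<in> T \<beta>}" "f \<alpha> n = thread_union A L (C \<alpha>) Map.empty n"
    by (simp_all add: T_def f_def)
qed

end

section \<open>Branches along the proxy sequence\<close>

text \<open>Since \<beta> is not the supremum of \<open>D\<close> below it, the least upper bound
  \<gamma> of \<open>D \<inter> {..<\<beta>}\<close> lies below \<beta>. Were \<gamma> outside
  \<open>D\<close>, it would be a limit of points of \<open>D\<close>, contradicting
  closedness.\<close>

lemma club_in_max:
  fixes \<alpha> :: "'k::wellorder"
  assumes D: "club_in D \<alpha>" and \<beta>: "\<beta> < \<alpha>" and ne: "D \<inter> {..<\<beta>} \<noteq> {}"
    and nacc: "\<not> sup_is (D \<inter> {..<\<beta>}) \<beta>"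
  obtains \<gamma> where "\<gamma> \<in> D" "\<gamma> < \<beta>" "\<And>\<delta>. \<delta> \<in> D \<Longrightarrow> \<delta> < \<beta> \<Longrightarrow> \<delta> \<le> \<gamma>"
proof -
  have "\<exists>\<delta><\<beta>. \<forall>x\<in>D \<inter> {..<\<beta>}. x \<le> \<delta>"
    using nacc unfolding sup_is_def by (auto simp: not_less)
  then obtain \<gamma> where \<gamma>: "\<gamma> < \<beta>" "\<forall>x\<in>D \<inter> {..<\<beta>}. x \<le> \<gamma>"
    and least: "\<And>\<delta>. \<delta> < \<gamma> \<Longrightarrow> \<not> (\<delta> < \<beta> \<and> (\<forall>x\<in>D \<inter> {..<\<beta>}. x \<le> \<delta>))"
    using exists_least_iff[of "\<lambda>\<delta>. \<delta> < \<beta> \<and> (\<forall>x\<in>D \<inter> {..<\<beta>}. x \<le> \<delta>)"] by blast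
  have "\<gamma> \<in> D"
  proof (rule ccontr)
    assume "\<gamma> \<notin> D"
    have lt: "x < \<gamma>" if "x \<in> D" "x < \<beta>" for x
      using \<gamma>(2) that \<open>\<gamma> \<notin> D\<close> by (metis IntI lessThan_iff order_le_less)
    obtain x0 where "x0 \<in> D" "x0 < \<beta>" using ne by auto
    then have "\<exists>\<beta>. \<beta> < \<gamma>" using lt by blast
    moreover have "sup_is (D \<inter> {..<\<gamma>}) \<gamma>"
      unfolding sup_is_def
    proof (intro conjI ballI allI impI)
      fix \<delta> assume "\<delta> < \<gamma>"
      then obtain x where "x \<in> D" "x < \<beta>" "\<delta> < x"
        using least[of \<delta>] \<gamma>(1) by (auto simp: not_le)
      then show "\<exists>x\<in>D \<inter> {..<\<gamma>}. \<delta> < x" using lt by auto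
    qed auto
    moreover have "\<gamma> < \<alpha>" using \<gamma>(1) \<beta> by (rule less_trans)
    ultimately show False using D \<open>\<gamma> \<notin> D\<close> unfolding club_in_def by blast
  qed
  with \<gamma> show ?thesis using that by simp
qed

lemma someI_bex: "\<exists>t\<in>X. P t \<Longrightarrow> (SOME t. t \<in> X \<and> P t) \<in> X \<and> P (SOME t. t \<in> X \<and> P t)"
  by (rule someI_ex) blast

lemma extension_props:
  assumes "\<exists>t\<in>fst (L \<beta>). s \<subseteq>\<^sub>m t" "snd (L \<beta>) n \<in> fst (L \<beta>)"
  shows "extension A L \<beta> n k s \<in> fst (L \<beta>)" "s \<subseteq>\<^sub>m extension A L \<beta> n k s"
proof -
  consider (asc) "k < n \<and> s \<subseteq>\<^sub>m snd (L \<beta>) n"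
    | (hit) "\<not> (k < n \<and> s \<subseteq>\<^sub>m snd (L \<beta>) n)" "\<exists>t\<in>fst (L \<beta>). s \<subseteq>\<^sub>m t \<and> (\<exists>w\<in>guessed A L \<beta>. w \<subseteq>\<^sub>m t)"
    | (any) "\<not> (k < n \<and> s \<subseteq>\<^sub>m snd (L \<beta>) n)" "\<not> (\<exists>t\<in>fst (L \<beta>). s \<subseteq>\<^sub>m t \<and> (\<exists>w\<in>guessed A L \<beta>. w \<subseteq>\<^sub>m t))"
    by blast
  then have "extension A L \<beta> n k s \<in> fst (L \<beta>) \<and> s \<subseteq>\<^sub>m extension A L \<beta> n k s"
  proof cases
    case asc
    then show ?thesis using assms(2) by (simp add: extension_def)
  next
    case hit
    from someI_bex[OF hit(2)] show ?thesis
      unfolding extension_def if_not_P[OF hit(1)] if_P[OF hit(2)] by blast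
  next
    case any
    from someI_bex[OF assms(1)] show ?thesis
      unfolding extension_def if_not_P[OF any(1)] if_not_P[OF any(2)] by blast
  qed
  then show "extension A L \<beta> n k s \<in> fst (L \<beta>)" "s \<subseteq>\<^sub>m extension A L \<beta> n k s" by auto
qed

lemma extension_hit:
  assumes "n \<le> k" "\<exists>t\<in>fst (L \<beta>). s \<subseteq>\<^sub>m t \<and> (\<exists>w\<in>guessed A L \<beta>. w \<subseteq>\<^sub>m t)"
  shows "\<exists>w\<in>guessed A L \<beta>. w \<subseteq>\<^sub>m extension A L \<beta> n k s"
proof -
  have "\<not> (k < n \<and> s \<subseteq>\<^sub>m snd (L \<beta>) n)" using assms(1) by simp
  note not_asc = if_not_P[OF this]
  from someI_bex[OF assms(2)] show ?thesis
    unfolding extension_def not_asc if_P[OF assms(2)] by blast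
qed

section \<open>The invariant of the levels\<close>

context construction
begin

text \<open>The clauses are proved by one induction because a limit level draws on all of them below
  it: extendibility carries a branch to the next point of \<open>C \<alpha>\<close>, and membership
  of the path in the levels makes following it a legal choice. Cofinite sets of indices are
  expressed through \<open>sequentially\<close> until \<open>ascent_path_f\<close>.\<close>

definition good :: "'k \<Rightarrow> bool" where
  "good \<alpha> \<longleftrightarrow> (\<forall>t\<in>T \<alpha>. dom t = {..<\<alpha>} \<and> (\<forall>\<beta><\<alpha>. t |` {..<\<beta>} \<in> T \<beta>))
     \<and> (\<forall>\<beta><\<alpha>. \<forall>s\<in>T \<beta>. \<exists>t\<in>T \<alpha>. s \<subseteq>\<^sub>m t)
     \<and> (\<forall>n. f \<alpha> n \<in> T \<alpha>)
     \<and> (\<forall>\<beta><\<alpha>. \<forall>\<^sub>F n in sequentially. f \<beta> n \<subseteq>\<^sub>m f \<alpha> n)"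

lemma good_dom: "good \<alpha> \<Longrightarrow> t \<in> T \<alpha> \<Longrightarrow> dom t = {..<\<alpha>}"
  and good_restrict: "good \<alpha> \<Longrightarrow> t \<in> T \<alpha> \<Longrightarrow> \<beta> < \<alpha> \<Longrightarrow> t |` {..<\<beta>} \<in> T \<beta>"
  and good_extend: "good \<alpha> \<Longrightarrow> \<beta> < \<alpha> \<Longrightarrow> s \<in> T \<beta> \<Longrightarrow> \<exists>t\<in>T \<alpha>. s \<subseteq>\<^sub>m t"
  and good_f: "good \<alpha> \<Longrightarrow> f \<alpha> n \<in> T \<alpha>"
  and good_asc: "good \<alpha> \<Longrightarrow> \<beta> < \<alpha> \<Longrightarrow> \<forall>\<^sub>F n in sequentially. f \<beta> n \<subseteq>\<^sub>m f \<alpha> n"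
  by (simp_all add: good_def)

lemma good_restrict_le:
  assumes "good \<alpha>" "t \<in> T \<alpha>" "\<beta> \<le> \<alpha>"
  shows "t |` {..<\<beta>} \<in> T \<beta>"
proof (cases "\<beta> = \<alpha>")
  case True
  then show ?thesis using assms good_dom map_le_restrict[OF map_le_refl] by metis
qed (use assms good_restrict in auto)

abbreviation B :: "'k \<Rightarrow> ('k \<rightharpoonup> 'k) \<Rightarrow> nat \<Rightarrow> 'k \<Rightarrow> ('k \<rightharpoonup> 'k)" where
  "B \<alpha> x n \<equiv> thread A L (C \<alpha>) x n"

text \<open>What the branch has reached before its node at \<beta> is chosen; this is the map handed
  to \<open>extension\<close>.\<close>

abbreviation S :: "'k \<Rightarrow> ('k \<rightharpoonup> 'k) \<Rightarrow> nat \<Rightarrow> 'k \<Rightarrow> ('k \<rightharpoonup> 'k)" where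
  "S \<alpha> x n \<beta> \<equiv> munion (insert x (B \<alpha> x n ` (C \<alpha> \<inter> {..<\<beta>})))"

lemma C_less: "is_limit \<alpha> \<Longrightarrow> \<beta> \<in> C \<alpha> \<Longrightarrow> \<beta> < \<alpha>"
  using clubC unfolding club_in_def by (metis lessThan_iff subsetD)

lemma C_above:
  assumes "is_limit \<alpha>" "\<beta> < \<alpha>"
  obtains \<gamma> where "\<gamma> \<in> C \<alpha>" "\<beta> < \<gamma>"
  using clubC[OF assms(1)] assms(2) unfolding club_in_def sup_is_def by blast

text \<open>\<open>sqsub\<close> leaves the cutting point \<delta> open. A cut beyond \<beta>, or
  none at all, would put \<beta> into \<open>C \<beta>\<close>; a cut before \<beta> would make
  \<open>C \<beta>\<close> bounded below \<beta>.\<close>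

lemma acc_eq:
  assumes "is_limit \<alpha>" "\<beta> \<in> C \<alpha>" "sup_is (C \<alpha> \<inter> {..<\<beta>}) \<beta>" "\<exists>\<gamma>. \<gamma> < \<beta>"
  shows "is_limit \<beta>" "C \<beta> = C \<alpha> \<inter> {..<\<beta>}"
proof -
  show lim: "is_limit \<beta>"
    using assms(3,4) unfolding is_limit_def sup_is_def by blast
  have acc: "\<beta> \<in> Defs.acc (C \<alpha>)" using assms unfolding acc_def by blast
  have sub: "C \<beta> \<subseteq> {..<\<beta>}" "sup_is (C \<beta>) \<beta>" using clubC[OF lim] unfolding club_in_def by auto
  from coherent[OF acc] consider "C \<beta> = C \<alpha>" | \<delta> where "C \<beta> = C \<alpha> \<inter> {..<\<delta>}"
    unfolding sqsub_def by blast
  then show "C \<beta> = C \<alpha> \<inter> {..<\<beta>}"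
  proof cases
    case 1
    then show ?thesis using sub(1) assms(2) by auto
  next
    case 2
    have "\<delta> \<le> \<beta>"
      using 2 assms(2) sub(1) by (metis IntI lessThan_iff less_irrefl not_le subsetD)
    moreover have "\<not> \<delta> < \<beta>"
    proof
      assume "\<delta> < \<beta>"
      then obtain x where "x \<in> C \<beta>" "\<delta> < x" using sub(2) unfolding sup_is_def by blast
      then show False using 2 by (metis IntD2 lessThan_iff less_asym)
    qed
    ultimately show ?thesis using 2 by simp
  qed
qed

text \<open>At an accumulation point the branch continues along the node that coherence has already put
  into the tree.\<close>

lemma S_acc:
  assumes "is_limit \<alpha>" "\<beta> \<in> C \<alpha>" "sup_is (C \<alpha> \<inter> {..<\<beta>}) \<beta>" "\<exists>\<gamma>. \<gamma> < \<beta>"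
  shows "S \<alpha> x n \<beta> = thread_union A L (C \<beta>) x n"
proof -
  note C = acc_eq(2)[OF assms]
  have "B \<alpha> x n ` C \<beta> = B \<beta> x n ` C \<beta>"
  proof (intro image_cong refl thread_cong)
    fix \<gamma> assume "\<gamma> \<in> C \<beta>"
    then have "\<gamma> < \<beta>" using C by auto
    then have "{..<\<beta>} \<inter> {..<\<gamma>} = {..<\<gamma>}" by auto
    then show "C \<alpha> \<inter> {..<\<gamma>} = C \<beta> \<inter> {..<\<gamma>}" using C by (metis Int_assoc)
  qed
  then show ?thesis unfolding thread_union_def C[symmetric] by simp
qed

lemma thread_restrict: "{..<\<beta>} \<subseteq> dom x \<Longrightarrow> B \<alpha> x n \<beta> = x |` {..<\<beta>}"
  by (simp add: thread_unfold[of A L "C \<alpha>"])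

lemma thread_ext: "\<not> {..<\<beta>} \<subseteq> dom x \<Longrightarrow> B \<alpha> x n \<beta> = extension A L \<beta> n (fin_rank (C \<alpha>) \<beta>) (S \<alpha> x n \<beta>)"
  by (subst thread_unfold) simp

section \<open>A single thread at a limit level\<close>

context
  fixes \<alpha> \<gamma>0 :: 'k and x :: "'k \<rightharpoonup> 'k" and n :: nat
  assumes lim: "is_limit \<alpha>" and IH: "\<And>\<beta>. \<beta> < \<alpha> \<Longrightarrow> good \<beta>"
    and x: "x \<in> T \<gamma>0" "\<gamma>0 < \<alpha>"
begin

definition ok :: "'k \<Rightarrow> bool" where
  "ok \<beta> \<longleftrightarrow> B \<alpha> x n \<beta> \<in> T \<beta> \<and> (\<gamma>0 \<le> \<beta> \<longrightarrow> x \<subseteq>\<^sub>m B \<alpha> x n \<beta>)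
      \<and> (\<forall>\<gamma>\<in>C \<alpha>. \<gamma> < \<beta> \<longrightarrow> B \<alpha> x n \<gamma> \<subseteq>\<^sub>m B \<alpha> x n \<beta>)"

lemma dom_x: "dom x = {..<\<gamma>0}"
  using good_dom[OF IH[OF x(2)] x(1)] .

lemma thread_below: "\<beta> \<le> \<gamma>0 \<Longrightarrow> B \<alpha> x n \<beta> = x |` {..<\<beta>}"
  by (rule thread_restrict) (auto simp: dom_x)

lemma thread_above: "\<gamma>0 < \<beta> \<Longrightarrow> B \<alpha> x n \<beta> = extension A L \<beta> n (fin_rank (C \<alpha>) \<beta>) (S \<alpha> x n \<beta>)"
  by (rule thread_ext) (auto simp: dom_x)

lemma comparable_x: "ok \<beta> \<Longrightarrow> x \<subseteq>\<^sub>m B \<alpha> x n \<beta> \<or> B \<alpha> x n \<beta> \<subseteq>\<^sub>m x"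
  by (metis thread_below ok_def linear restrict_map_le)

lemma chain_ok:
  assumes "D \<subseteq> C \<alpha>" "\<And>\<gamma>. \<gamma> \<in> D \<Longrightarrow> ok \<gamma>"
  shows "tree_chain (insert x (B \<alpha> x n ` D))"
proof -
  have "B \<alpha> x n \<gamma> \<subseteq>\<^sub>m B \<alpha> x n \<delta> \<or> B \<alpha> x n \<delta> \<subseteq>\<^sub>m B \<alpha> x n \<gamma>" if "\<gamma> \<in> D" "\<delta> \<in> D" for \<gamma> \<delta>
    using assms that unfolding ok_def by (metis linorder_neqE map_le_refl subsetD)
  then show ?thesis
    unfolding tree_chain_def using comparable_x[OF assms(2)] by auto
qed

lemma S_root:
  assumes ok: "\<And>\<gamma>. \<gamma> \<in> C \<alpha> \<Longrightarrow> \<gamma> < \<beta> \<Longrightarrow> ok \<gamma>"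
    and below: "\<And>\<gamma>. \<gamma> \<in> C \<alpha> \<Longrightarrow> \<gamma> < \<beta> \<Longrightarrow> \<gamma> \<le> \<gamma>0"
  shows "S \<alpha> x n \<beta> = x"
proof (rule munion_greatest)
  show "tree_chain (insert x (B \<alpha> x n ` (C \<alpha> \<inter> {..<\<beta>})))" using ok by (intro chain_ok) auto
  fix t assume "t \<in> insert x (B \<alpha> x n ` (C \<alpha> \<inter> {..<\<beta>}))"
  then show "t \<subseteq>\<^sub>m x" using thread_below[OF below] by (auto simp: restrict_map_le)
qed auto

lemma S_max:
  assumes ok: "\<And>\<gamma>. \<gamma> \<in> C \<alpha> \<Longrightarrow> \<gamma> < \<beta> \<Longrightarrow> ok \<gamma>"
    and \<gamma>: "\<gamma> \<in> C \<alpha>" "\<gamma> < \<beta>" "\<gamma>0 \<le> \<gamma>"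
    and max: "\<And>\<delta>. \<delta> \<in> C \<alpha> \<Longrightarrow> \<delta> < \<beta> \<Longrightarrow> \<delta> \<le> \<gamma>"
  shows "S \<alpha> x n \<beta> = B \<alpha> x n \<gamma>"
proof (rule munion_greatest)
  show "tree_chain (insert x (B \<alpha> x n ` (C \<alpha> \<inter> {..<\<beta>})))" using ok by (intro chain_ok) auto
  show "B \<alpha> x n \<gamma> \<in> insert x (B \<alpha> x n ` (C \<alpha> \<inter> {..<\<beta>}))" using \<gamma> by auto
  fix t assume t: "t \<in> insert x (B \<alpha> x n ` (C \<alpha> \<inter> {..<\<beta>}))"
  show "t \<subseteq>\<^sub>m B \<alpha> x n \<gamma>"
  proof (cases "t = x")
    case True
    then show ?thesis using ok[OF \<gamma>(1,2)] \<gamma>(3) unfolding ok_def by blast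
  next
    case False
    then obtain \<delta> where "t = B \<alpha> x n \<delta>" "\<delta> \<in> C \<alpha>" "\<delta> < \<beta>" using t by auto
    moreover from this have "\<delta> \<le> \<gamma>" using max by blast
    ultimately show ?thesis using ok[OF \<gamma>(1,2)] unfolding ok_def
      by (cases "\<delta> = \<gamma>") auto
  qed
qed

text \<open>At an accumulation point, \<open>S_acc\<close> turns the part built so far into a branch
  that the limit clause has put into level \<beta>. Otherwise \<open>C \<alpha>\<close> has a last
  point before \<beta>, or none from \<open>\<gamma>0\<close> on, and that part is the node chosen
  there, or \<open>x\<close>.\<close>

lemma S_cases:
  assumes \<beta>: "\<beta> \<in> C \<alpha>" "\<gamma>0 < \<beta>" and ok: "\<And>\<gamma>. \<gamma> \<in> C \<alpha> \<Longrightarrow> \<gamma> < \<beta> \<Longrightarrow> ok \<gamma>"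
  shows "sup_is (C \<alpha> \<inter> {..<\<beta>}) \<beta> \<Longrightarrow> S \<alpha> x n \<beta> \<in> T \<beta>"
    and "\<not> sup_is (C \<alpha> \<inter> {..<\<beta>}) \<beta> \<Longrightarrow> \<exists>\<gamma><\<beta>. S \<alpha> x n \<beta> \<in> T \<gamma>"
proof -
  assume acc: "sup_is (C \<alpha> \<inter> {..<\<beta>}) \<beta>"
  have "\<exists>\<gamma>. \<gamma> < \<beta>" using \<beta> by blast
  note acc = lim \<beta>(1) acc this
  show "S \<alpha> x n \<beta> \<in> T \<beta>"
    unfolding S_acc[OF acc] level_limit(1)[OF acc_eq(1)[OF acc]] using x(1) \<beta>(2) by blast
next
  assume nacc: "\<not> sup_is (C \<alpha> \<inter> {..<\<beta>}) \<beta>"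
  show "\<exists>\<gamma><\<beta>. S \<alpha> x n \<beta> \<in> T \<gamma>"
  proof (cases "\<exists>\<gamma>\<in>C \<alpha>. \<gamma> < \<beta> \<and> \<gamma>0 \<le> \<gamma>")
    case False
    then have "S \<alpha> x n \<beta> = x" using ok by (intro S_root) auto
    then show ?thesis using x(1) \<beta>(2) by auto
  next
    case True
    then have "C \<alpha> \<inter> {..<\<beta>} \<noteq> {}" by auto
    then obtain \<gamma> where \<gamma>: "\<gamma> \<in> C \<alpha>" "\<gamma> < \<beta>" "\<And>\<delta>. \<delta> \<in> C \<alpha> \<Longrightarrow> \<delta> < \<beta> \<Longrightarrow> \<delta> \<le> \<gamma>"
      using club_in_max[OF clubC[OF lim] C_less[OF lim \<beta>(1)] _ nacc] by blast
    have "\<gamma>0 \<le> \<gamma>" using True \<gamma>(3) by (meson order_trans)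
    then have "S \<alpha> x n \<beta> = B \<alpha> x n \<gamma>" using S_max[OF ok \<gamma>(1,2) _ \<gamma>(3)] by blast
    then show ?thesis using ok[OF \<gamma>(1,2)] \<gamma>(2) unfolding ok_def by auto
  qed
qed

lemma S_extend:
  assumes \<beta>: "\<beta> \<in> C \<alpha>" "\<gamma>0 < \<beta>" and ok: "\<And>\<gamma>. \<gamma> \<in> C \<alpha> \<Longrightarrow> \<gamma> < \<beta> \<Longrightarrow> ok \<gamma>"
  shows "\<exists>t\<in>T \<beta>. S \<alpha> x n \<beta> \<subseteq>\<^sub>m t"
proof (cases "sup_is (C \<alpha> \<inter> {..<\<beta>}) \<beta>")
  case True
  then show ?thesis using S_cases(1)[OF assms] map_le_refl by blast
next
  case False
  then show ?thesis using S_cases(2)[OF assms] good_extend[OF IH[OF C_less[OF lim \<beta>(1)]]] by blast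
qed

text \<open>Induction along \<open>C \<alpha>\<close>. Up to \<open>\<gamma>0\<close> all values are
  restrictions of \<open>x\<close>. Beyond it the choice in \<open>extension\<close> cannot fail,
  since \<open>S_extend\<close> supplies a node of level \<beta> over the part built so far.\<close>

lemma ok: "\<beta> \<in> C \<alpha> \<Longrightarrow> ok \<beta>"
proof (induction \<beta> rule: less_induct)
  case (less \<beta>)
  have g: "good \<beta>" using IH C_less[OF lim less.prems] by blast
  show ?case
  proof (cases "\<beta> \<le> \<gamma>0")
    case True
    have "x |` {..<\<beta>} \<in> T \<beta>" using good_restrict_le[OF IH x(1)] x(2) True by blast
    moreover have "x \<subseteq>\<^sub>m x |` {..<\<beta>}" if "\<gamma>0 \<le> \<beta>"
      using that True by (intro restrict_mono) (auto simp: dom_x)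
    moreover have "x |` {..<\<gamma>} \<subseteq>\<^sub>m x |` {..<\<beta>}" if "\<gamma> < \<beta>" for \<gamma>
      using that by (intro restrict_mono restrict_map_le) auto
    ultimately show ?thesis
      unfolding ok_def using True by (auto simp: thread_below)
  next
    case False
    then have "\<gamma>0 < \<beta>" by simp
    let ?D = "C \<alpha> \<inter> {..<\<beta>}"
    have ch: "tree_chain (insert x (B \<alpha> x n ` ?D))" using less.IH by (intro chain_ok) auto
    have s: "\<exists>t\<in>fst (L \<beta>). S \<alpha> x n \<beta> \<subseteq>\<^sub>m t"
      using S_extend[OF less.prems \<open>\<gamma>0 < \<beta>\<close> less.IH] by (simp add: T_def)
    have fn: "snd (L \<beta>) n \<in> fst (L \<beta>)" using good_f[OF g] by (simp add: T_def f_def)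
    note e = extension_props[of L \<beta>, OF s fn, of A "fin_rank (C \<alpha>) \<beta>", folded thread_above[OF \<open>\<gamma>0 < \<beta>\<close>]]
    have "t \<subseteq>\<^sub>m B \<alpha> x n \<beta>" if "t \<in> insert x (B \<alpha> x n ` ?D)" for t
      using munion_upper[OF ch that] e(2) map_le_trans by blast
    then show ?thesis using e(1) unfolding ok_def T_def by auto
  qed
qed

lemma dom_thread: "\<beta> \<in> C \<alpha> \<Longrightarrow> dom (B \<alpha> x n \<beta>) = {..<\<beta>}"
  using ok good_dom[OF IH[OF C_less[OF lim]]] unfolding ok_def by blast

lemma thread_lim: "\<beta> \<in> C \<alpha> \<Longrightarrow> B \<alpha> x n \<beta> \<subseteq>\<^sub>m thread_union A L (C \<alpha>) x n"
  and x_lim: "x \<subseteq>\<^sub>m thread_union A L (C \<alpha>) x n"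
  unfolding thread_union_def using chain_ok[OF subset_refl ok] by (auto intro: munion_upper)

lemma dom_lim: "dom (thread_union A L (C \<alpha>) x n) = {..<\<alpha>}"
proof -
  have "dom (thread_union A L (C \<alpha>) x n) = (\<Union>t\<in>insert x (B \<alpha> x n ` C \<alpha>). dom t)"
    unfolding thread_union_def by (intro dom_munion chain_ok subset_refl ok)
  also have "\<dots> = {..<\<gamma>0} \<union> (\<Union>\<beta>\<in>C \<alpha>. {..<\<beta>})" by (simp add: dom_x dom_thread)
  also have "\<dots> = {..<\<alpha>}"
  proof (intro equalityI subsetI)
    fix \<xi> assume "\<xi> \<in> {..<\<alpha>}"
    then show "\<xi> \<in> {..<\<gamma>0} \<union> (\<Union>\<beta>\<in>C \<alpha>. {..<\<beta>})" using C_above[OF lim, of \<xi>] by auto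
  qed (use x(2) C_less[OF lim] in \<open>auto intro: less_trans\<close>)
  finally show ?thesis .
qed

text \<open>As \<open>C \<alpha>\<close> is cofinal, the branch up to \<beta> is part of the node
  chosen at some later point of \<open>C \<alpha>\<close>, whose restrictions are in the tree by the
  induction hypothesis.\<close>

lemma lim_restrict:
  assumes "\<beta> < \<alpha>"
  shows "thread_union A L (C \<alpha>) x n |` {..<\<beta>} \<in> T \<beta>"
proof -
  obtain \<gamma> where \<gamma>: "\<gamma> \<in> C \<alpha>" "\<beta> < \<gamma>" using C_above[OF lim assms] .
  have "thread_union A L (C \<alpha>) x n |` {..<\<gamma>} = B \<alpha> x n \<gamma>"
    using thread_lim[OF \<gamma>(1)] dom_thread[OF \<gamma>(1)] by (rule map_le_restrict)
  moreover have "{..<\<gamma>} \<inter> {..<\<beta>} = {..<\<beta>}" using \<gamma>(2) by auto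
  ultimately have "thread_union A L (C \<alpha>) x n |` {..<\<beta>} = B \<alpha> x n \<gamma> |` {..<\<beta>}"
    using Map.restrict_restrict[of "thread_union A L (C \<alpha>) x n" "{..<\<gamma>}" "{..<\<beta>}"] by (simp only:)
  then show ?thesis
    using good_restrict[OF IH[OF C_less[OF lim \<gamma>(1)]] _ \<gamma>(2)] ok[OF \<gamma>(1)] unfolding ok_def by simp
qed

end

text \<open>Induction along \<open>C \<alpha>\<close>; the exceptional \<open>n\<close> depend on
  \<beta>. At an accumulation point the part built so far equals \<open>f \<beta> n\<close> by
  coherence and the definition of the path at limits. At any other point it is empty or the node at
  the preceding point \<gamma>, for large \<open>n\<close> equal to \<open>f \<gamma> n\<close> and
  thus below \<open>f \<beta> n\<close>. In each case \<open>n\<close> beyond the rank makes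
  \<open>extension\<close> choose the path.\<close>

lemma thread_agrees_f:
  assumes lim: "is_limit \<alpha>" and IH: "\<And>\<beta>. \<beta> < \<alpha> \<Longrightarrow> good \<beta>" and \<beta>: "\<beta> \<in> C \<alpha>"
  shows "\<forall>\<^sub>F n in sequentially. B \<alpha> Map.empty n \<beta> = f \<beta> n"
  using \<beta>
proof (induction \<beta> rule: less_induct)
  case (less \<beta>)
  \<comment> \<open>\<open>z\<close> is the ordinal 0, whose level consists of the empty map alone;
    the threads defining the path start there.\<close>
  define z :: 'k where "z = (LEAST z. True)"
  have z: "\<not> \<beta> < z" for \<beta> unfolding z_def by (simp add: not_less Least_le)
  have \<beta>: "\<beta> < \<alpha>" using less.prems C_less[OF lim] by blast
  have z_le: "z \<le> \<gamma>" for \<gamma> using z by (simp add: not_less)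
  have x: "Map.empty \<in> T z" "z < \<alpha>" using level_zero(1)[OF z] le_less_trans[OF z_le \<beta>] by auto
  note ctx = lim IH x
  show ?case
  proof (cases "\<beta> = z")
    case True
    then show ?thesis using thread_below[OF ctx] level_zero(2)[OF z] by simp
  next
    case False
    then have zb: "z < \<beta>" using z_le[of \<beta>] by simp
    let ?M = "\<lambda>n. S \<alpha> Map.empty n \<beta>"
    have thread: "B \<alpha> Map.empty n \<beta> = extension A L \<beta> n (fin_rank (C \<alpha>) \<beta>) (?M n)" for n
      by (rule thread_above[OF ctx zb])
    have follow: "?M n \<subseteq>\<^sub>m f \<beta> n \<Longrightarrow> fin_rank (C \<alpha>) \<beta> < n \<Longrightarrow> B \<alpha> Map.empty n \<beta> = f \<beta> n" for n
      unfolding thread by (simp add: extension_def f_def)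
    have large: "\<forall>\<^sub>F n in sequentially. fin_rank (C \<alpha>) \<beta> < n" by (rule eventually_gt_at_top)
    show ?thesis
    proof (cases "sup_is (C \<alpha> \<inter> {..<\<beta>}) \<beta>")
      case True
      have "\<exists>\<gamma>. \<gamma> < \<beta>" using zb by blast
      note acc = lim less.prems True this
      have "?M n = f \<beta> n" for n
        unfolding S_acc[OF acc] level_limit(2)[OF acc_eq(1)[OF acc]] ..
      then show ?thesis using follow by (intro eventually_mono[OF large]) simp
    next
      case nacc: False
      show ?thesis
      proof (cases "C \<alpha> \<inter> {..<\<beta>} = {}")
        case True
        then have "?M n = Map.empty" for n by (simp add: munion_def)
        then show ?thesis using follow by (intro eventually_mono[OF large]) simp
      next
        case False
        obtain \<gamma> where \<gamma>: "\<gamma> \<in> C \<alpha>" "\<gamma> < \<beta>" "\<And>\<delta>. \<delta> \<in> C \<alpha> \<Longrightarrow> \<delta> < \<beta> \<Longrightarrow> \<delta> \<le> \<gamma>"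
          using club_in_max[OF clubC[OF lim] \<beta> False nacc] by blast
        from z_le have M: "?M n = B \<alpha> Map.empty n \<gamma>" for n
          using S_max[OF ctx ok[OF ctx] \<gamma>(1,2) _ \<gamma>(3)] by blast
        have "\<forall>\<^sub>F n in sequentially. B \<alpha> Map.empty n \<gamma> = f \<gamma> n" by (rule less.IH[OF \<gamma>(2,1)])
        moreover have "\<forall>\<^sub>F n in sequentially. f \<gamma> n \<subseteq>\<^sub>m f \<beta> n"
          by (rule good_asc[OF IH[OF \<beta>] \<gamma>(2)])
        ultimately show ?thesis using large
        proof eventually_elim
          case (elim n)
          then show ?case by (intro follow) (simp_all add: M)
        qed
      qed
    qed
  qed
qed

lemma good_limit:
  assumes lim: "is_limit \<alpha>" and IH: "\<And>\<beta>. \<beta> < \<alpha> \<Longrightarrow> good \<beta>"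
  shows "good \<alpha>"
  unfolding good_def
proof (intro conjI ballI allI impI)
  fix t assume "t \<in> T \<alpha>"
  then obtain x n \<gamma> where t: "t = thread_union A L (C \<alpha>) x n" and x: "x \<in> T \<gamma>" "\<gamma> < \<alpha>"
    unfolding level_limit(1)[OF lim] by auto
  show "dom t = {..<\<alpha>}" unfolding t by (rule dom_lim[OF lim IH x])
  show "t |` {..<\<beta>} \<in> T \<beta>" if "\<beta> < \<alpha>" for \<beta> unfolding t by (rule lim_restrict[OF lim IH x that])
next
  fix \<beta> x assume x: "\<beta> < \<alpha>" "x \<in> T \<beta>"
  then have "thread_union A L (C \<alpha>) x 0 \<in> T \<alpha>" unfolding level_limit(1)[OF lim] by blast
  then show "\<exists>t\<in>T \<alpha>. x \<subseteq>\<^sub>m t" using x_lim[OF lim IH x(2,1)] by blast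
next
  define z :: 'k where "z = (LEAST z. True)"
  have z: "\<not> \<beta> < z" for \<beta> unfolding z_def by (simp add: not_less Least_le)
  obtain b where "b < \<alpha>" using lim unfolding is_limit_def by blast
  then have x: "Map.empty \<in> T z" "z < \<alpha>"
    using level_zero(1)[OF z] z[of b] by (simp_all add: not_less le_less_trans)
  show "f \<alpha> n \<in> T \<alpha>" for n unfolding level_limit[OF lim] using x by blast
  fix \<beta> assume "\<beta> < \<alpha>"
  \<comment> \<open>The comparison passes through a point \<gamma> of \<open>C \<alpha>\<close>
    beyond \<beta>: for large \<open>n\<close>, \<open>f \<beta> n\<close> is below
    \<open>f \<gamma> n\<close>, which is the thread's node at \<gamma> and hence below
    \<open>f \<alpha> n\<close>.\<close>
  then obtain \<gamma> where \<gamma>: "\<gamma> \<in> C \<alpha>" "\<beta> < \<gamma>" using C_above[OF lim] by blast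
  have "\<forall>\<^sub>F n in sequentially. B \<alpha> Map.empty n \<gamma> = f \<gamma> n"
    using thread_agrees_f lim IH \<gamma>(1) by blast
  moreover have "\<forall>\<^sub>F n in sequentially. f \<beta> n \<subseteq>\<^sub>m f \<gamma> n"
    using IH C_less[OF lim \<gamma>(1)] \<gamma>(2) good_asc by blast
  ultimately
  show "\<forall>\<^sub>F n in sequentially. f \<beta> n \<subseteq>\<^sub>m f \<alpha> n"
  proof eventually_elim
    case (elim n)
    have "B \<alpha> Map.empty n \<gamma> \<subseteq>\<^sub>m f \<alpha> n"
      unfolding level_limit(2)[OF lim] by (rule thread_lim[OF lim IH x \<gamma>(1)])
    with elim show ?case using map_le_trans by metis
  qed
qed

lemma good_sc:
  assumes g: "good \<gamma>"
  shows "good (sc \<gamma>)"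
proof -
  have upd: "t \<subseteq>\<^sub>m t(\<gamma> \<mapsto> i)" if "t \<in> T \<gamma>" for t i
    using good_dom[OF g that] by (auto simp: map_le_def)
  show ?thesis unfolding good_def
  proof (intro conjI ballI allI impI)
    fix t assume "t \<in> T (sc \<gamma>)"
    then obtain x i where t: "t = x(\<gamma> \<mapsto> i)" and x: "x \<in> T \<gamma>" unfolding level_sc by blast
    have "dom t = insert \<gamma> {..<\<gamma>}" using good_dom[OF g x] by (simp add: t)
    also have "\<dots> = {..<sc \<gamma>}" unfolding lessThan_sc by auto
    finally show "dom t = {..<sc \<gamma>}" .
    fix \<beta> assume "\<beta> < sc \<gamma>"
    then have "\<beta> \<le> \<gamma>" by (simp add: less_sc_iff)
    then have "\<not> \<gamma> < \<beta>" by simp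
    then have "t |` {..<\<beta>} = x |` {..<\<beta>}" unfolding t by (simp add: restrict_map_def fun_eq_iff)
    then show "t |` {..<\<beta>} \<in> T \<beta>" using good_restrict_le[OF g x \<open>\<beta> \<le> \<gamma>\<close>] by simp
  next
    fix \<beta> s assume "\<beta> < sc \<gamma>" and s: "s \<in> T \<beta>"
    then consider "\<beta> < \<gamma>" | "\<beta> = \<gamma>" by (auto simp: less_sc_iff le_less)
    then obtain t where t: "t \<in> T \<gamma>" "s \<subseteq>\<^sub>m t"
      using s good_extend[OF g] map_le_refl by metis
    have "e 0 < max omega_k \<gamma>" using e(2)[of 0] by (simp add: less_max_iff_disj)
    then have "t(\<gamma> \<mapsto> e 0) \<in> T (sc \<gamma>)" unfolding level_sc using t by blast
    then show "\<exists>t\<in>T (sc \<gamma>). s \<subseteq>\<^sub>m t" using upd[OF t(1)] t(2) map_le_trans by blast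
  next
    fix n
    have "e n < max omega_k \<gamma>" using e(2)[of n] by (simp add: less_max_iff_disj)
    then show "f (sc \<gamma>) n \<in> T (sc \<gamma>)" unfolding level_sc using good_f[OF g] by blast
  next
    fix \<beta> assume "\<beta> < sc \<gamma>"
    then consider "\<beta> < \<gamma>" | "\<beta> = \<gamma>" by (auto simp: less_sc_iff le_less)
    then have "\<forall>\<^sub>F n in sequentially. f \<beta> n \<subseteq>\<^sub>m f \<gamma> n"
      by cases (use good_asc[OF g] in auto)
    then show "\<forall>\<^sub>F n in sequentially. f \<beta> n \<subseteq>\<^sub>m f (sc \<gamma>) n"
    proof eventually_elim
      case (elim n)
      then show ?case unfolding level_sc(2) using upd[OF good_f[OF g]] by (rule map_le_trans)
    qed
  qed
qed

lemma good: "good \<alpha>"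
proof (induction \<alpha> rule: less_induct)
  case (less \<alpha>)
  show ?case
  proof (cases \<alpha> rule: ordinal_cases)
    case zero
    then have "{..<\<alpha>} = {}" by auto
    with zero show ?thesis unfolding good_def by (simp add: level_zero[OF zero])
  next
    case (succ \<gamma>)
    then show ?thesis using good_sc less sc_greater by blast
  next
    case limit
    then show ?thesis using good_limit less by blast
  qed
qed

end

section \<open>The Souslin property\<close>

text \<open>An infinite well-ordered set always has a next element after a finite initial part, so
  its elements can be counted off from the bottom. Used in \<open>sealing\<close> to reach a
  prescribed position in an \<omega>-block.\<close>

lemma infinite_initial_segments:
  fixes D :: "'k::wellorder set"
  assumes "infinite D"
  shows "\<exists>\<delta>\<in>D. finite (D \<inter> {..<\<delta>}) \<and> card (D \<inter> {..<\<delta>}) = m"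
proof (induction m)
  case 0
  obtain \<delta> where "\<delta> \<in> D" "\<And>\<gamma>. \<gamma> < \<delta> \<Longrightarrow> \<gamma> \<notin> D"
    using assms exists_least_iff[of "\<lambda>\<delta>. \<delta> \<in> D"] by (metis ex_in_conv finite.emptyI)
  moreover from this have "D \<inter> {..<\<delta>} = {}" by auto
  ultimately show ?case by (intro bexI[of _ \<delta>]) simp_all
next
  case (Suc m)
  then obtain \<delta> where \<delta>: "\<delta> \<in> D" "finite (D \<inter> {..<\<delta>})" "card (D \<inter> {..<\<delta>}) = m" by blast
  have "D \<inter> {\<delta><..} \<noteq> {}"
  proof
    assume "D \<inter> {\<delta><..} = {}"
    then have "D \<subseteq> insert \<delta> (D \<inter> {..<\<delta>})" by (auto simp: not_less)
    then show False using assms \<delta>(2) finite_subset by blast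
  qed
  then obtain \<epsilon> where \<epsilon>: "\<epsilon> \<in> D" "\<delta> < \<epsilon>" "\<And>\<gamma>. \<gamma> < \<epsilon> \<Longrightarrow> \<not> (\<gamma> \<in> D \<and> \<delta> < \<gamma>)"
    using exists_least_iff[of "\<lambda>\<gamma>. \<gamma> \<in> D \<and> \<delta> < \<gamma>"] by auto
  then have "D \<inter> {..<\<epsilon>} = insert \<delta> (D \<inter> {..<\<delta>})" using \<delta>(1) by (force simp: not_less)
  then show ?case using \<epsilon>(1) \<delta> by (intro bexI[of _ \<epsilon>]) auto
qed

lemma tree_chain_below:
  assumes "s \<subseteq>\<^sub>m t" "u \<subseteq>\<^sub>m t" "dom s = {..<\<alpha>}" "dom u = {..<\<beta>::'k::wellorder}"
  shows "s \<subseteq>\<^sub>m u \<or> u \<subseteq>\<^sub>m s"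
proof -
  have eq: "t |` {..<\<alpha>} = s" "t |` {..<\<beta>} = u" using assms by (simp_all add: map_le_restrict)
  show ?thesis
  proof (cases "\<alpha> \<le> \<beta>")
    case True
    then have "s \<subseteq>\<^sub>m t |` {..<\<beta>}" using assms(1,3) by (intro restrict_mono) auto
    then show ?thesis using eq by simp
  next
    case False
    then have "u \<subseteq>\<^sub>m t |` {..<\<alpha>}" using assms(2,4) by (intro restrict_mono) auto
    then show ?thesis using eq by simp
  qed
qed

lemma segment_max_mono: "\<beta> \<le> \<alpha> \<Longrightarrow> {..<max \<kappa> \<beta>} \<subseteq> {..<max \<kappa> (\<alpha>::'k::wellorder)}"
  unfolding lessThan_subset_iff by (rule max.mono[OF order_refl])

lemma (in reg_card) pair_code_inj: "pair_code (\<alpha>::'k, \<beta>) = pair_code (\<gamma>, \<delta>) \<longleftrightarrow> \<alpha> = \<gamma> \<and> \<beta> = \<delta>"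
proof -
  have "infinite (UNIV::'k set)" using uncountable_UNIV countable_finite by blast
  then have "(UNIV::'k set) \<times> (UNIV::'k set) \<lesssim> (UNIV::'k set)"
    by (rule infinite_times_lepoll) auto
  then have "\<exists>p::'k \<times> 'k \<Rightarrow> 'k. inj p" unfolding lepoll_def by auto
  then have "inj (pair_code :: 'k \<times> 'k \<Rightarrow> 'k)" unfolding pair_code_def by (rule someI_ex)
  then show ?thesis by (auto dest: injD)
qed

section \<open>Level sizes and the sealing of dense sets\<close>

context construction
begin

lemma level_lepoll: "T \<alpha> \<lesssim> {..<max omega_k \<alpha>}"
proof (induction \<alpha> rule: less_induct)
  case (less \<alpha>)
  show ?case
  proof (cases \<alpha> rule: ordinal_cases)
    case zero
    then show ?thesis
      by (simp add: level_zero[OF zero] finite_lepoll_infinite[OF infinite_max_omega_k])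
  next
    case (succ \<gamma>)
    let ?M = "{..<max omega_k \<gamma>}"
    have "T \<alpha> = (\<lambda>(x, i). x(\<gamma> \<mapsto> i)) ` (T \<gamma> \<times> ?M)"
      unfolding succ level_sc by auto
    then have "T \<alpha> \<lesssim> T \<gamma> \<times> ?M" by (simp add: image_lepoll)
    also have "\<dots> \<lesssim> ?M"
      using less sc_greater succ by (intro infinite_times_lepoll infinite_max_omega_k) auto
    also have "\<dots> \<lesssim> {..<max omega_k \<alpha>}"
      using segment_max_mono[OF less_imp_le[OF sc_greater]] succ by (simp add: subset_imp_lepoll)
    finally show ?thesis .
  next
    case limit
    let ?M = "{..<max omega_k \<alpha>}"
    have "T \<alpha> = (\<lambda>(x, n). thread_union A L (C \<alpha>) x n) ` ((\<Union>\<beta>\<in>{..<\<alpha>}. T \<beta>) \<times> UNIV)"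
      unfolding level_limit[OF limit] by force
    then have "T \<alpha> \<lesssim> (\<Union>\<beta>\<in>{..<\<alpha>}. T \<beta>) \<times> (UNIV::nat set)" by (simp add: image_lepoll)
    also have "\<dots> \<lesssim> ?M"
    proof (rule infinite_times_lepoll[OF infinite_max_omega_k])
      show "(UNIV::nat set) \<lesssim> ?M" using infinite_max_omega_k infinite_le_lepoll by blast
      show "(\<Union>\<beta>\<in>{..<\<alpha>}. T \<beta>) \<lesssim> ?M"
      proof (rule infinite_UN_lepoll[OF infinite_max_omega_k])
        show "{..<\<alpha>} \<lesssim> ?M" by (intro subset_imp_lepoll) auto
        fix \<beta> assume "\<beta> \<in> {..<\<alpha>}"
        then have "T \<beta> \<lesssim> {..<max omega_k \<beta>}" "{..<max omega_k \<beta>} \<subseteq> ?M"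
          using less by (simp_all only: lessThan_iff segment_max_mono less_imp_le)
        then show "T \<beta> \<lesssim> ?M" using lepoll_trans subset_imp_lepoll by blast
      qed
    qed
    finally show ?thesis .
  qed
qed

lemma level_lesspoll: "T \<alpha> \<prec> (UNIV::'k set)"
  by (rule lesspoll_trans1[OF level_lepoll segment_lesspoll])

definition Tree :: "('k \<rightharpoonup> 'k) set" where
  "Tree = (\<Union>\<alpha>. T \<alpha>)"

lemma level_Tree: "level Tree \<alpha> = T \<alpha>"
proof -
  have "t \<in> T \<alpha>" if "t \<in> T \<beta>" "dom t = {..<\<alpha>}" for t \<beta>
    using that good_dom[OF good] by (metis lessThan_eq_iff)
  then show ?thesis unfolding level_def Tree_def using good_dom[OF good] by blast
qed

lemma code_inj:
  assumes "s \<in> T \<alpha>" "t \<in> T \<beta>" "code L \<alpha> s = code L \<beta> t"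
  shows "\<alpha> = \<beta> \<and> s = t"
proof -
  have "\<exists>g::('k \<rightharpoonup> 'k) \<Rightarrow> 'k. inj_on g (fst (L \<alpha>))"
    using level_lepoll[of \<alpha>] unfolding lepoll_def T_def by blast
  then have "inj_on (SOME g::('k \<rightharpoonup> 'k) \<Rightarrow> 'k. inj_on g (fst (L \<alpha>))) (T \<alpha>)"
    unfolding T_def by (rule someI_ex)
  then show ?thesis using assms unfolding code_def pair_code_inj by (auto dest: inj_onD)
qed

text \<open>The whole \<omega>-block of guesses provided by the proxy principle is needed: the \<open>n\<close>-th thread
  ignores the guess at the first \<open>n\<close> points of the block.\<close>

lemma sealing:
  assumes W: "W \<subseteq> Tree" and dense: "\<And>s. s \<in> Tree \<Longrightarrow> \<exists>w\<in>W. s \<subseteq>\<^sub>m w"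
  shows "\<exists>\<alpha>. \<forall>t\<in>T \<alpha>. \<exists>\<gamma><\<alpha>. \<exists>w\<in>W \<inter> T \<gamma>. w \<subseteq>\<^sub>m t"
proof -
  \<comment> \<open>The set of codes of \<open>W\<close>, a subset of \<kappa> that diamond can
    guess.\<close>
  define X where "X = {code L \<gamma> w | \<gamma> w. w \<in> W \<and> w \<in> T \<gamma>}"
  \<comment> \<open>The bounds are collected into \<open>g\<close>. At a point \<beta> closed under
    \<open>g\<close>, nodes below \<beta> have codes below \<beta>, and each has an extension in
    \<open>W\<close> of height below \<beta>.\<close>
  have "\<exists>b. sc \<gamma> < b \<and> (\<forall>s\<in>T \<gamma>. code L \<gamma> s < b \<and> (\<exists>\<delta><b. \<exists>w\<in>W \<inter> T \<delta>. s \<subseteq>\<^sub>m w))" for \<gamma>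
  proof -
    have "\<forall>s\<in>T \<gamma>. \<exists>\<delta>. \<exists>w\<in>W \<inter> T \<delta>. s \<subseteq>\<^sub>m w"
      using dense W unfolding Tree_def by blast
    then obtain h where h: "\<forall>s\<in>T \<gamma>. \<exists>w\<in>W \<inter> T (h s). s \<subseteq>\<^sub>m w" by metis
    obtain b1 where b1: "h ` T \<gamma> \<subseteq> {..<b1}" using bounded_image[OF level_lesspoll] by blast
    obtain b2 where b2: "code L \<gamma> ` T \<gamma> \<subseteq> {..<b2}" using bounded_image[OF level_lesspoll] by blast
    obtain b where b: "max (sc \<gamma>) (max b1 b2) < b" using ex_greater by blast
    have "code L \<gamma> s < b \<and> (\<exists>\<delta><b. \<exists>w\<in>W \<inter> T \<delta>. s \<subseteq>\<^sub>m w)" if s: "s \<in> T \<gamma>" for s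
    proof
      show "code L \<gamma> s < b" using b2 s b by (auto intro: less_trans)
      have "h s < b" using b1 s b by (auto intro: less_trans)
      then show "\<exists>\<delta><b. \<exists>w\<in>W \<inter> T \<delta>. s \<subseteq>\<^sub>m w" using h s by blast
    qed
    then show ?thesis using b by auto
  qed
  then obtain g where g: "\<And>\<gamma>. sc \<gamma> < g \<gamma>" "\<And>\<gamma> s. s \<in> T \<gamma> \<Longrightarrow> code L \<gamma> s < g \<gamma>"
    "\<And>\<gamma> s. s \<in> T \<gamma> \<Longrightarrow> \<exists>\<delta><g \<gamma>. \<exists>w\<in>W \<inter> T \<delta>. s \<subseteq>\<^sub>m w" by metis
  \<comment> \<open>At these points \<open>A \<beta>\<close> decodes to exactly the part of
    \<open>W\<close> below \<beta>, and every node below \<beta> extends to level \<beta> through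
    that part.\<close>
  define E where "E = {\<beta>. (\<forall>\<gamma><\<beta>. g \<gamma> < \<beta>) \<and> X \<inter> {..<\<beta>} = A \<beta>}"
  have guessed: "guessed A L \<beta> = {w\<in>W. \<exists>\<gamma><\<beta>. w \<in> T \<gamma>}" if \<beta>: "\<beta> \<in> E" for \<beta>
  proof -
    have "code L \<gamma> t \<in> A \<beta> \<longleftrightarrow> t \<in> W" if t: "t \<in> T \<gamma>" "\<gamma> < \<beta>" for t \<gamma>
    proof -
      have "code L \<gamma> t < \<beta>" using g(2)[OF t(1)] \<beta> t(2) less_trans unfolding E_def by blast
      then have "code L \<gamma> t \<in> A \<beta> \<longleftrightarrow> code L \<gamma> t \<in> X" using \<beta> unfolding E_def by blast
      also have "\<dots> \<longleftrightarrow> t \<in> W" unfolding X_def using code_inj t(1) by blast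
      finally show ?thesis .
    qed
    then show ?thesis unfolding guessed_def T_def by blast
  qed
  have hit: "\<exists>t\<in>T \<beta>. s \<subseteq>\<^sub>m t \<and> (\<exists>w\<in>guessed A L \<beta>. w \<subseteq>\<^sub>m t)"
    if \<beta>: "\<beta> \<in> E" and s: "s \<in> T \<gamma>" "\<gamma> < \<beta>" for \<beta> s \<gamma>
  proof -
    obtain \<delta> w where w: "\<delta> < g \<gamma>" "w \<in> W" "w \<in> T \<delta>" "s \<subseteq>\<^sub>m w" using g(3)[OF s(1)] by blast
    have "\<delta> < \<beta>" using w(1) \<beta> s(2) less_trans unfolding E_def by blast
    then have "w \<in> guessed A L \<beta>" using guessed[OF \<beta>] w by blast
    moreover obtain t where "t \<in> T \<beta>" "w \<subseteq>\<^sub>m t" using good_extend[OF good \<open>\<delta> < \<beta>\<close> w(3)] by blast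
    ultimately show ?thesis using w(4) map_le_trans by blast
  qed
  have "cofinal E" unfolding cofinal_def
  proof
    fix \<delta>
    \<comment> \<open>Cofinality of \<open>E\<close>: the stationary set of correct guesses meets
      the club of closure points above \<delta>.\<close>
    have "{\<beta>. X \<inter> {..<\<beta>} = A \<beta>} \<inter> {\<beta>. \<delta> < \<beta> \<and> (\<forall>\<gamma><\<beta>. g \<gamma> < \<beta>)} \<noteq> {}"
      using dia[of X] club_closure_points[of \<delta> g] unfolding stationary_def by blast
    then show "\<exists>\<beta>\<in>E. \<delta> < \<beta>" unfolding E_def by blast
  qed
  note st = guess[OF this]
  define z :: 'k where "z = (LEAST z. True)"
  \<comment> \<open>Closure under \<open>sc\<close> makes the nonzero \<alpha> a limit, so its nodes
    are thread unions.\<close>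
  obtain \<alpha> where
    sup: "(\<exists>i. i < \<alpha>) \<longrightarrow> sup_is {\<beta>\<in>C \<alpha>. succ_omega {\<gamma>\<in>C \<alpha>. \<beta> \<le> \<gamma>} \<subseteq> E} \<alpha>"
    and \<alpha>: "z < \<alpha>" "\<forall>\<gamma><\<alpha>. sc \<gamma> < \<alpha>"
    using st club_closure_points[of z sc] unfolding stationary_def by blast
  have lim: "is_limit \<alpha>" unfolding is_limit_def using \<alpha> sc_greater by blast
  show ?thesis
  proof (rule exI[of _ \<alpha>], rule ballI)
    fix t assume "t \<in> T \<alpha>"
    then obtain x n \<gamma>0 where t: "t = thread_union A L (C \<alpha>) x n" and x: "x \<in> T \<gamma>0" "\<gamma>0 < \<alpha>"
      unfolding level_limit(1)[OF lim] by auto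
    note ctx = lim good x
    obtain \<beta> where \<beta>: "\<beta> \<in> C \<alpha>" "succ_omega {\<gamma>\<in>C \<alpha>. \<beta> \<le> \<gamma>} \<subseteq> E" "\<gamma>0 < \<beta>"
      using sup x(2) unfolding sup_is_def by blast
    let ?D = "{\<gamma>\<in>C \<alpha>. \<beta> \<le> \<gamma>}"
    have "infinite ?D"
    proof
      assume fin: "finite ?D"
      have "Max ?D \<in> ?D" using \<beta>(1) by (intro Max_in[OF fin]) auto
      then obtain \<gamma> where \<gamma>: "\<gamma> \<in> C \<alpha>" "Max ?D < \<gamma>" "\<beta> \<le> Max ?D"
        using C_above[OF lim] C_less[OF lim] by blast
      then have "\<gamma> \<in> ?D" by auto
      then show False using Max_ge[OF fin] \<gamma>(2) not_le by blast
    qed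
    \<comment> \<open>The count is \<open>Suc n\<close>, not \<open>n\<close>: \<delta> must differ
      from \<beta> even for \<open>n = 0\<close>, since \<open>succ_omega\<close> omits the first
      point of the block. The rank of \<delta> is then also at least \<open>n\<close>, so thread
      \<open>n\<close> heeds the guess there.\<close>
    then obtain \<delta> where \<delta>: "\<delta> \<in> ?D" "finite (?D \<inter> {..<\<delta>})" "card (?D \<inter> {..<\<delta>}) = Suc n"
      using infinite_initial_segments by blast
    let ?F = "C \<alpha> \<inter> {\<beta>..<\<delta>}"
    have F: "?D \<inter> {..<\<delta>} = ?F" by auto
    have ne: "?F \<noteq> {}" using \<delta>(3) unfolding F by auto
    have "\<delta> \<in> succ_omega ?D" unfolding succ_omega_def using \<delta> ne F by auto
    then have \<delta>E: "\<delta> \<in> E" using \<beta>(2) by blast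
    have rank: "n \<le> fin_rank (C \<alpha>) \<delta>"
      using fin_rank_ge[of "C \<alpha>" \<beta> \<delta>] \<delta>(2,3) unfolding F by simp
    have \<delta>': "\<delta> \<in> C \<alpha>" "\<gamma>0 < \<delta>" using \<delta>(1) \<beta>(3) by auto
    \<comment> \<open>The finite nonempty \<open>?F\<close> has a maximum, which is the last point
      of \<open>C \<alpha>\<close> before \<delta>. So the part built so far lies on a lower level,
      where \<open>hit\<close> applies.\<close>
    have nacc: "\<not> sup_is (C \<alpha> \<inter> {..<\<delta>}) \<delta>"
    proof
      assume "sup_is (C \<alpha> \<inter> {..<\<delta>}) \<delta>"
      moreover have fin: "finite ?F" using \<delta>(2) unfolding F .
      note Max_in[OF fin ne]
      ultimately obtain \<gamma> where "\<gamma> \<in> C \<alpha>" "\<gamma> < \<delta>" "Max ?F < \<gamma>" "\<beta> \<le> Max ?F"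
        unfolding sup_is_def by auto
      then have "\<gamma> \<in> ?F" by auto
      then show False using Max_ge[OF fin] \<open>Max ?F < \<gamma>\<close> not_le by blast
    qed
    obtain \<gamma> where \<gamma>: "\<gamma> < \<delta>" "S \<alpha> x n \<delta> \<in> T \<gamma>"
      using S_cases(2)[OF ctx \<delta>' ok[OF ctx] nacc] by blast
    have "\<exists>w\<in>guessed A L \<delta>. w \<subseteq>\<^sub>m B \<alpha> x n \<delta>"
      unfolding thread_above[OF ctx \<delta>'(2)]
      by (rule extension_hit[OF rank]) (use hit[OF \<delta>E \<gamma>(2,1)] in \<open>simp add: T_def\<close>)
    then obtain w where w: "w \<in> guessed A L \<delta>" "w \<subseteq>\<^sub>m t"
      using thread_lim[OF ctx \<delta>'(1)] map_le_trans unfolding t by blast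
    then show "\<exists>\<gamma><\<alpha>. \<exists>w\<in>W \<inter> T \<gamma>. w \<subseteq>\<^sub>m t"
      unfolding guessed[OF \<delta>E] using C_less[OF lim \<delta>'(1)] less_trans by blast
  qed
qed

section \<open>The required properties of the tree\<close>

lemma Tree_dom:
  assumes "t \<in> Tree"
  obtains \<alpha> where "t \<in> T \<alpha>" "dom t = {..<\<alpha>}"
  using assms good_dom[OF good] unfolding Tree_def by blast

lemma Tree_restrict:
  assumes "t \<in> T \<alpha>" "s \<subseteq>\<^sub>m t" "dom s = {..<\<beta>}"
  shows "\<beta> \<le> \<alpha>" "s \<in> T \<beta>"
proof -
  have "{..<\<beta>} \<subseteq> {..<\<alpha>}"
    using map_le_implies_dom_le[OF assms(2)] assms(3) good_dom[OF good assms(1)] by simp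
  then show "\<beta> \<le> \<alpha>" by (simp add: lessThan_subset_iff)
  then show "s \<in> T \<beta>"
    using good_restrict_le[OF good assms(1)] map_le_restrict[OF assms(2,3)] by metis
qed

lemma prolific_Tree: "prolific Tree"
  unfolding prolific_def
proof (intro allI ballI impI)
  fix \<alpha> x i assume "x \<in> level Tree \<alpha>" "i < max omega_k \<alpha>"
  then have "x(\<alpha> \<mapsto> i) \<in> T (sc \<alpha>)" unfolding level_Tree level_sc by blast
  then show "x(\<alpha> \<mapsto> i) \<in> Tree" unfolding Tree_def by blast
qed

text \<open>The nodes off a branch are dense: two distinct one-point extensions of a node are
  incomparable, so a chain misses one of them. Sealing then puts a node off the branch below the
  branch's own node at some level, although maximality makes a branch downward closed.\<close>

lemma no_cofinal_branch: "\<not> cofinal_branch Tree Br"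
proof
  assume "cofinal_branch Tree Br"
  then have Br: "Br \<subseteq> Tree" "tree_chain Br" "\<And>\<alpha>. Br \<inter> level Tree \<alpha> \<noteq> {}"
    and maximal: "\<And>t. t \<in> Tree \<Longrightarrow> (\<And>s. s \<in> Br \<Longrightarrow> s \<subseteq>\<^sub>m t \<or> t \<subseteq>\<^sub>m s) \<Longrightarrow> t \<in> Br"
    unfolding cofinal_branch_def by blast+
  have "\<exists>w\<in>Tree - Br. s \<subseteq>\<^sub>m w" if s: "s \<in> Tree" for s
  proof -
    obtain \<alpha> where \<alpha>: "s \<in> T \<alpha>" "dom s = {..<\<alpha>}" using Tree_dom[OF s] .
    have u: "s(\<alpha> \<mapsto> e n) \<in> Tree" for n
      using prolific_Tree \<alpha>(1) e(2)[of n] unfolding prolific_def level_Tree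
      by (simp add: less_max_iff_disj)
    have "\<not> s(\<alpha> \<mapsto> e 0) \<subseteq>\<^sub>m s(\<alpha> \<mapsto> e 1)" "\<not> s(\<alpha> \<mapsto> e 1) \<subseteq>\<^sub>m s(\<alpha> \<mapsto> e 0)"
      using e(1) by (auto simp: map_le_def inj_eq)
    then obtain n where "s(\<alpha> \<mapsto> e n) \<notin> Br" using Br(2) unfolding tree_chain_def by blast
    moreover have "s \<subseteq>\<^sub>m s(\<alpha> \<mapsto> e n)" for n using \<alpha>(2) by (auto simp: map_le_def)
    ultimately show ?thesis using u by blast
  qed
  then obtain \<alpha> where \<alpha>: "\<forall>t\<in>T \<alpha>. \<exists>\<gamma><\<alpha>. \<exists>w\<in>(Tree - Br) \<inter> T \<gamma>. w \<subseteq>\<^sub>m t"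
    using sealing[of "Tree - Br"] by blast
  obtain t where t: "t \<in> Br" "t \<in> T \<alpha>" using Br(3)[of \<alpha>] unfolding level_Tree by blast
  then obtain w where w: "w \<in> Tree" "w \<notin> Br" "w \<subseteq>\<^sub>m t" using \<alpha> by blast
  have "w \<in> Br"
  proof (rule maximal[OF w(1)])
    fix s assume s: "s \<in> Br"
    then consider "s \<subseteq>\<^sub>m t" | "t \<subseteq>\<^sub>m s" using Br(2) t(1) unfolding tree_chain_def by blast
    then show "s \<subseteq>\<^sub>m w \<or> w \<subseteq>\<^sub>m s"
    proof cases
      case 1
      obtain \<beta> \<gamma> where "dom s = {..<\<beta>}" "dom w = {..<\<gamma>}"
        using Tree_dom s Br(1) w(1) by (metis subsetD)
      then show ?thesis using tree_chain_below[OF 1 w(3)] by blast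
    next
      case 2
      then show ?thesis using w(3) map_le_trans by blast
    qed
  qed
  then show False using w(2) by blast
qed

text \<open>\<open>W\<close> consists of the nodes above a member of \<open>X\<close> and those
  below none; it is dense. If all nodes of level \<alpha> are above members of \<open>W\<close> of
  lower height, a member \<open>a\<close> of \<open>X\<close> of height at least \<alpha> has such a
  \<open>w\<close> below it. Then \<open>w\<close> must lie above some \<open>b\<close> in
  \<open>X\<close>, which equals \<open>a\<close> by the antichain property, although its height is
  below \<alpha>. So \<open>X\<close> lives below \<alpha>, where there are fewer than \<kappa>
  nodes.\<close>

lemma no_large_antichain:
  assumes A: "X \<subseteq> Tree" "tree_antichain X"
  shows "\<not> X \<approx> (UNIV::'k set)"
proof -
  define W where "W = {s\<in>Tree. (\<exists>a\<in>X. a \<subseteq>\<^sub>m s) \<or> (\<forall>a\<in>X. \<not> s \<subseteq>\<^sub>m a)}"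
  have "\<exists>w\<in>W. s \<subseteq>\<^sub>m w" if "s \<in> Tree" for s
  proof (cases "\<exists>a\<in>X. s \<subseteq>\<^sub>m a")
    case True
    then obtain a where "a \<in> X" "s \<subseteq>\<^sub>m a" by blast
    moreover from this have "a \<in> W" unfolding W_def using A(1) map_le_refl by blast
    ultimately show ?thesis by blast
  next
    case False
    then have "s \<in> W" unfolding W_def using that by blast
    then show ?thesis using map_le_refl by blast
  qed
  then obtain \<alpha> where \<alpha>: "\<forall>t\<in>T \<alpha>. \<exists>\<gamma><\<alpha>. \<exists>w\<in>W \<inter> T \<gamma>. w \<subseteq>\<^sub>m t"
    using sealing[of W] unfolding W_def by blast
  have "X \<subseteq> (\<Union>\<beta>\<in>{..<\<alpha>}. T \<beta>)"
  proof
    fix a assume a: "a \<in> X"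
    then obtain \<beta> where \<beta>: "a \<in> T \<beta>" using A(1) unfolding Tree_def by blast
    have "\<beta> < \<alpha>"
    proof (rule ccontr)
      assume "\<not> \<beta> < \<alpha>"
      then have "a |` {..<\<alpha>} \<in> T \<alpha>" using good_restrict_le[OF good \<beta>] by simp
      then obtain \<gamma> w where w: "\<gamma> < \<alpha>" "w \<in> W" "w \<in> T \<gamma>" "w \<subseteq>\<^sub>m a |` {..<\<alpha>}" using \<alpha> by blast
      then have wa: "w \<subseteq>\<^sub>m a" using restrict_map_le map_le_trans by blast
      then obtain b where b: "b \<in> X" "b \<subseteq>\<^sub>m w" using w(2) a unfolding W_def by blast
      then have "b = a" using A(2) a wa map_le_trans unfolding tree_antichain_def by blast
      then have "{..<\<beta>} \<subseteq> {..<\<gamma>}"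
        using map_le_implies_dom_le[OF b(2)] good_dom[OF good \<beta>] good_dom[OF good w(3)] by simp
      then show False using w(1) \<open>\<not> \<beta> < \<alpha>\<close> by (simp add: lessThan_subset_iff)
    qed
    then show "a \<in> (\<Union>\<beta>\<in>{..<\<alpha>}. T \<beta>)" using \<beta> by blast
  qed
  moreover have "(\<Union>\<beta>\<in>{..<\<alpha>}. T \<beta>) \<lesssim> {..<max omega_k \<alpha>}"
  proof (rule infinite_UN_lepoll[OF infinite_max_omega_k])
    show "{..<\<alpha>} \<lesssim> {..<max omega_k \<alpha>}" by (intro subset_imp_lepoll) auto
    fix \<beta> assume "\<beta> \<in> {..<\<alpha>}"
    then have "{..<max omega_k \<beta>} \<subseteq> {..<max omega_k \<alpha>}"
      by (simp only: lessThan_iff segment_max_mono less_imp_le)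
    then show "T \<beta> \<lesssim> {..<max omega_k \<alpha>}" using level_lepoll lepoll_trans subset_imp_lepoll by blast
  qed
  ultimately have "X \<prec> (UNIV::'k set)"
    using lepoll_trans lesspoll_trans1 segment_lesspoll subset_imp_lepoll by blast
  then show ?thesis unfolding lesspoll_def by blast
qed

lemma downward_closed_Tree: "downward_closed_tree Tree"
  unfolding downward_closed_tree_def
proof (intro conjI ballI allI impI)
  fix t assume t: "t \<in> Tree"
  then show "is_node t" unfolding is_node_def using Tree_dom by metis
  fix s assume s: "is_node s \<and> strict_ext s t"
  then obtain \<beta> where "dom s = {..<\<beta>}" unfolding is_node_def by blast
  moreover obtain \<alpha> where "t \<in> T \<alpha>" using t unfolding Tree_def by blast
  ultimately have "s \<in> T \<beta>" using Tree_restrict(2) s unfolding strict_ext_def by blast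
  then show "s \<in> Tree" unfolding Tree_def by blast
qed

lemma slim_Tree: "slim Tree"
  unfolding slim_def level_Tree
proof
  fix \<alpha> :: 'k
  show "if finite {..<\<alpha>} then countable (T \<alpha>) else T \<alpha> \<lesssim> {..<\<alpha>}"
  proof (cases "finite {..<\<alpha>}")
    case True
    then have "max omega_k \<alpha> = omega_k"
      by (intro max_absorb1) (simp add: finite_below_omega_k[symmetric] less_imp_le)
    then show ?thesis using True countable_lepoll[OF countable_omega_k] level_lepoll[of \<alpha>] by simp
  next
    case False
    then have "max omega_k \<alpha> = \<alpha>"
      by (intro max_absorb2) (simp add: finite_below_omega_k[symmetric] not_less)
    then show ?thesis using False level_lepoll[of \<alpha>] by simp
  qed
qed

lemma souslin_Tree: "souslin Tree"
  unfolding souslin_def level_Tree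
  using good_f[OF good] level_lesspoll no_cofinal_branch no_large_antichain by blast

lemma ascent_path_f: "ascent_path Tree f"
  unfolding ascent_path_def level_Tree
proof (intro conjI allI impI)
  show "f \<alpha> n \<in> T \<alpha>" for \<alpha> n by (rule good_f[OF good])
  fix \<alpha> \<beta> :: 'k assume less: "\<alpha> < \<beta>"
  have "f \<alpha> n \<noteq> f \<beta> n" for n
    using good_dom[OF good good_f[OF good]] less by (metis lessThan_eq_iff less_irrefl)
  then have eq: "UNIV - {n. strict_ext (f \<alpha> n) (f \<beta> n)} = {n. \<not> f \<alpha> n \<subseteq>\<^sub>m f \<beta> n}"
    unfolding strict_ext_def by blast
  have "\<forall>\<^sub>F n in cofinite. f \<alpha> n \<subseteq>\<^sub>m f \<beta> n"
    using good_asc[OF good less] unfolding cofinite_eq_sequentially .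
  then show "{n. strict_ext (f \<alpha> n) (f \<beta> n)} \<in> Ffin"
    unfolding Ffin_def eventually_cofinite by (simp add: eq)
qed

lemma injective_ascent_f: "injective_ascent f"
proof -
  define z :: 'k where "z = (LEAST z. True)"
  have z: "\<not> \<beta> < z" for \<beta> unfolding z_def by (simp add: not_less Least_le)
  have "f (sc z) n = [z \<mapsto> e n]" for n by (simp add: level_sc level_zero[OF z])
  then have "inj_on (f (sc z)) UNIV" using e(1) by (auto simp: inj_on_def fun_upd_eqD dest: fun_upd_eqD)
  moreover have "UNIV \<in> Ffin" by (simp add: Ffin_def)
  ultimately show ?thesis unfolding injective_ascent_def by blast
qed

end

theorem theorem4p1:
  assumes "reg_uncountable_cardinal TYPE('k::wellorder)"
    and "P14_mu1 (sqsub :: 'k set \<Rightarrow> 'k set \<Rightarrow> bool) {UNIV}"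
  shows "\<exists>T :: ('k \<rightharpoonup> 'k) set. downward_closed_tree T \<and> prolific T \<and> slim T \<and> souslin T
           \<and> (\<exists>f. ascent_path T f \<and> injective_ascent f)"
proof -
  obtain C :: "'k \<Rightarrow> 'k set" where
    C: "\<forall>\<alpha>. is_limit \<alpha> \<longrightarrow> club_in (C \<alpha>) \<alpha>"
      "\<forall>\<alpha> \<alpha>'. \<alpha>' \<in> Defs.acc (C \<alpha>) \<longrightarrow> sqsub (C \<alpha>') (C \<alpha>)"
      "\<forall>A. cofinal A \<longrightarrow> stationary {\<alpha>. (\<exists>i. i < \<alpha>) \<longrightarrow>
            sup_is {\<beta>\<in>C \<alpha>. succ_omega {\<gamma>\<in>C \<alpha>. \<beta> \<le> \<gamma>} \<subseteq> A} \<alpha>}"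
    using assms(2) unfolding P14_mu1_def P14_minus_mu1_def by auto
  obtain A :: "'k \<Rightarrow> 'k set" where A: "\<forall>X. stationary {\<alpha>. X \<inter> {..<\<alpha>} = A \<alpha>}"
    using assms(2) unfolding P14_mu1_def diamond_def by blast
  interpret construction "TYPE('k)" C A
  proof
    show "reg_uncountable_cardinal TYPE('k)" by (rule assms(1))
    show "club_in (C \<alpha>) \<alpha>" if "is_limit \<alpha>" for \<alpha> using C(1) that by simp
    show "sqsub (C \<alpha>') (C \<alpha>)" if "\<alpha>' \<in> Defs.acc (C \<alpha>)" for \<alpha> \<alpha>' using C(2) that by simp
    show "stationary {\<alpha>. (\<exists>i. i < \<alpha>) \<longrightarrow>
        sup_is {\<beta>\<in>C \<alpha>. succ_omega {\<gamma>\<in>C \<alpha>. \<beta> \<le> \<gamma>} \<subseteq> B} \<alpha>}" if "cofinal B" for B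
      using C(3) that by simp
    show "stationary {\<alpha>. X \<inter> {..<\<alpha>} = A \<alpha>}" for X using A by simp
  qed
  show ?thesis
    by (intro exI[of _ Tree] exI[of _ f] conjI downward_closed_Tree prolific_Tree slim_Tree
        souslin_Tree ascent_path_f injective_ascent_f)
qed

end
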